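(* Let $c>0$ and let $Q_N(\zeta)=\tfrac12\xi^2+\tfrac12\tfrac{N}{c^2}\eta^2$ for $\zeta=\xi+i\eta\in\mathbb{C}$. Let $\{\zeta_j\}_1^N$ be a random sample from the Gibbs measure associated with $Q_N$ (at $\beta=1$), with $1$-point function $\mathbf{R}_N$. Fix $p_*$ with $-2<p_*<2$ and let $$R_N(z)=\frac1{N\Delta Q_N(p_* )}\,\mathbf{R}_N(\zeta),\qquad z=\sqrt{N\Delta Q_N(p_* )}\,(\zeta-p_* ),$$ be the $1$-point function of the process rescaled about $p_*$. Then, as $N\to\infty$, $R_N$ converges locally uniformly on $\mathbb{C}$ to the limit $R(z)=F(2\operatorname{Im}z)$, where $$F(z)=\frac1{\sqrt{2\pi}}\int_{-2a}^{2a}e^{-\frac12(z-t)^2}\,dt,\qquad a=\pi\cdot c\cdot\sigma_{\mathrm{sc}}(p_* ),\qquad \sigma_{\mathrm{sc}}(\xi)=\tfrac1{2\pi}\sqrt{4-\xi^2}\cdot\mathbf{1}_{[-2,2]}(\xi).$$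
   Context: $dA(\zeta)=\tfrac1\pi\,d\xi\,d\eta$ is normalized Lebesgue measure on $\mathbb{C}$, $dA_N=(dA)^{\otimes N}$, and $\Delta=\tfrac14\left(\frac{\partial^2}{\partial\xi^2}+\frac{\partial^2}{\partial\eta^2}\right)$ (one quarter of the usual Laplacian). For a potential $Q_N$ put $H_N=\sum_{j\ne k}\log\frac1{|\zeta_j-\zeta_k|}+N\sum_{j=1}^NQ_N(\zeta_j)$. The Gibbs measure at $\beta=1$ is $d\mathbf{P}_N=\frac1{Z_N}e^{-H_N}\,dA_N$ on $\mathbb{C}^N$. The $1$-point function is $\mathbf{R}_N(\zeta)=\lim_{\varepsilon\to0}\varepsilon^{-2}\,\mathbf{E}_N[\#(\{\zeta_j\}_1^N\cap D(\zeta,\varepsilon))]$, where $D(\zeta,\varepsilon)$ is the open disc with center $\zeta$ and radius $\varepsilon$. *)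

theory Defs
  imports "HOL-Probability.Probability"
begin

text \<open>Normalized Lebesgue measure \<open>dA\<close> on the plane (the unit disc has mass 1).\<close>
definition area_measure :: "complex measure" where
  "area_measure = density lborel (\<lambda>_. ennreal (1 / pi))"

text \<open>Elements of \<open>\<complex>\<^sup>N\<close> are functions on the index set \<open>{..<N}\<close>.\<close>
definition area_measure_pow :: "nat \<Rightarrow> (nat \<Rightarrow> complex) measure" where
  "area_measure_pow N = Pi\<^sub>M {..<N} (\<lambda>_. area_measure)"

definition quarter_laplacian :: "(complex \<Rightarrow> real) \<Rightarrow> complex \<Rightarrow> real" where
  "quarter_laplacian f \<zeta> =
     (1 / 4) * (deriv (deriv (\<lambda>x. f (Complex x (Im \<zeta>)))) (Re \<zeta>)
              + deriv (deriv (\<lambda>y. f (Complex (Re \<zeta>) y))) (Im \<zeta>))"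

text \<open>On configurations with two coinciding points the energy is mathematically \<open>+\<infinity>\<close>, whereas
  here \<open>ln (1 / 0) = 0\<close>; these configurations form a null set and do not affect the Gibbs measure.\<close>
definition hamiltonian :: "nat \<Rightarrow> (complex \<Rightarrow> real) \<Rightarrow> (nat \<Rightarrow> complex) \<Rightarrow> real" where
  "hamiltonian N Q \<zeta> =
     (\<Sum>(j, k) \<in> {(j, k). j < N \<and> k < N \<and> j \<noteq> k}. ln (1 / cmod (\<zeta> j - \<zeta> k)))
     + real N * (\<Sum>j<N. Q (\<zeta> j))"

definition partition_function :: "nat \<Rightarrow> (complex \<Rightarrow> real) \<Rightarrow> real" where
  "partition_function N Q = (\<integral>\<zeta>. exp (- hamiltonian N Q \<zeta>) \<partial>area_measure_pow N)"

text \<open>The inverse temperature is \<open>\<beta> = 1\<close>; as the sum in the energy runs over ordered pairs, this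
  is the determinantal case.\<close>
definition gibbs_measure :: "nat \<Rightarrow> (complex \<Rightarrow> real) \<Rightarrow> (nat \<Rightarrow> complex) measure" where
  "gibbs_measure N Q =
     density (area_measure_pow N)
       (\<lambda>\<zeta>. ennreal (exp (- hamiltonian N Q \<zeta>) / partition_function N Q))"

definition one_point_function :: "nat \<Rightarrow> (complex \<Rightarrow> real) \<Rightarrow> complex \<Rightarrow> real" where
  "one_point_function N Q w =
     Lim (at_right 0) (\<lambda>\<epsilon>::real.
       (\<integral>\<zeta>. real (card {j \<in> {..<N}. \<zeta> j \<in> ball w \<epsilon>}) \<partial>gibbs_measure N Q) / \<epsilon>\<^sup>2)"

text \<open>The point \<open>w\<close> with \<open>z = sqrt (N \<Delta>Q(p)) (w - p)\<close> is \<open>w = p + z / sqrt (N \<Delta>Q(p))\<close>.\<close>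
definition rescaled_one_point_function ::
    "nat \<Rightarrow> (complex \<Rightarrow> real) \<Rightarrow> complex \<Rightarrow> complex \<Rightarrow> real" where
  "rescaled_one_point_function N Q p z =
     one_point_function N Q (p + z / complex_of_real (sqrt (real N * quarter_laplacian Q p)))
       / (real N * quarter_laplacian Q p)"

definition potential :: "real \<Rightarrow> nat \<Rightarrow> complex \<Rightarrow> real" where
  "potential c N \<zeta> = (1 / 2) * (Re \<zeta>)\<^sup>2 + (1 / 2) * (real N / c\<^sup>2) * (Im \<zeta>)\<^sup>2"

definition semicircle_density :: "real \<Rightarrow> real" where
  "semicircle_density x = 1 / (2 * pi) * sqrt (4 - x\<^sup>2) * indicator {-2..2} x"

definition limit_profile :: "real \<Rightarrow> real \<Rightarrow> real" where
  "limit_profile a x =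
     1 / sqrt (2 * pi) * integral {-2 * a..2 * a} (\<lambda>t. exp (- (1 / 2) * (x - t)\<^sup>2))"

end

theory Submission
  imports Defs "HOL-Complex_Analysis.Complex_Analysis" "HOL-Real_Asymp.Real_Asymp"
    "Jordan_Normal_Form.Determinant"
begin

text \<open>
  At \<open>\<beta> = 1\<close> the ensemble is determinantal: by Vandermonde, the Gibbs density is up to a constant the squared
  modulus of a determinant in polynomials \<open>p\<^sub>n\<close> that are orthonormal for \<open>exp (- N Q) dA\<close>, and integrating out all
  but one particle leaves the 1-point function \<open>\<Sum>n<N. \<bar>p\<^sub>n\<bar>\<^sup>2 exp (- N Q)\<close>
  (\<open>one_point_function_orthogonal_polynomials\<close>). For \<open>N Q = a \<xi>\<^sup>2 + b \<eta>\<^sup>2\<close> the weight is Gaussian, and its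
  orthogonal polynomials are Hermite polynomials of a suitable variance (\<open>hermite_orthogonal\<close>).

  The proof avoids the asymptotics of individual Hermite polynomials by a probabilistic reading of this sum.
  Mehler's formula evaluates the full series \<open>\<Sum>n. \<bar>p\<^sub>n(\<zeta>)\<bar>\<^sup>2 exp (- N Q(\<zeta>))\<close>: it is the constant
  \<open>(a + b) / 2 = N \<Delta>Q\<close>, which is exactly the factor by which the 1-point function is rescaled. So for every
  \<open>\<zeta>\<close> the rescaled summands form a probability distribution on the levels \<open>n\<close>, and
  the rescaled 1-point function is the probability that a random level is smaller than \<open>N\<close>.
  Mehler's formula also gives the probability generating function of that level in closed form
  (\<open>level_weight_generating_function\<close>).

  It remains to find the limit distribution of \<open>n / N\<close>. The generating function at \<open>exp (- k / N)\<close> is the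
  \<open>k\<close>-th moment of \<open>exp (- n / N)\<close>. At \<open>\<zeta> = p + z / sqrt (N \<Delta>Q)\<close> it converges to the \<open>k\<close>-th moment of
  \<open>exp (- (p\<^sup>2 / 4 + T\<^sup>2 / (4 c\<^sup>2)))\<close>, where \<open>T\<close> is normal with mean \<open>2 Im z\<close> and variance \<open>1\<close>
  (\<open>generating_function_limit\<close>, \<open>limit_law_moment\<close>). On \<open>[0, 1]\<close> convergence of moments implies weak
  convergence, so the rescaled 1-point function tends to
  \<open>P (p\<^sup>2 / 4 + T\<^sup>2 / (4 c\<^sup>2) < 1) = P (\<bar>T\<bar> < c sqrt (4 - p\<^sup>2))\<close>. Since
  \<open>c sqrt (4 - p\<^sup>2)\<close> is twice the parameter \<open>\<pi> c \<sigma>\<^sub>s\<^sub>c(p)\<close> of the limit profile, this is its value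
  at \<open>2 Im z\<close>. The argument works for points
  \<open>z\<close> that vary with \<open>N\<close> along a convergent sequence, which makes the convergence uniform on compact sets.
\<close>

section \<open>The Vandermonde determinant in monic polynomials\<close>

lemma poly_eq_leading_coeff_prod_roots:
  fixes q :: "'a::idom poly"
  assumes deg: "degree q \<le> n" and inj: "inj_on x {..<n}"
    and roots: "\<And>i. i < n \<Longrightarrow> poly q (x i) = 0"
  shows "q = Polynomial.smult (coeff q n) (\<Prod>i<n. [:- x i, 1:])"
proof (rule ccontr)
  define V where "V = (\<Prod>i<n. [:- x i, 1:])"
  define d where "d = q - Polynomial.smult (coeff q n) V"
  assume "q \<noteq> Polynomial.smult (coeff q n) (\<Prod>i<n. [:- x i, 1:])"
  then have d: "d \<noteq> 0" by (simp add: d_def V_def)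
  have V: "degree V = n" "lead_coeff V = 1"
    unfolding V_def by (subst degree_prod_eq_sum_degree) (auto simp: lead_coeff_prod)
  have "degree d \<le> n"
    unfolding d_def using deg V(1) by (intro degree_diff_le order.trans[OF degree_smult_le]) auto
  moreover have "coeff d n = 0" using V by (simp add: d_def)
  ultimately have less: "degree d < n \<or> n = 0"
    using d by (metis eq_zero_or_degree_less neq0_conv)
  have sub: "x ` {..<n} \<subseteq> {a. poly d a = 0}"
    using roots by (auto simp: d_def V_def poly_prod prod_zero_iff)
  have "n = card (x ` {..<n})" using inj by (simp add: card_image)
  also have "\<dots> \<le> card {a. poly d a = 0}"
    by (rule card_mono[OF poly_roots_finite[OF d] sub])
  also have "\<dots> \<le> degree d" by (rule card_poly_roots_bound[OF d])
  finally have "n = 0" using less by simp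
  then show False using \<open>degree d \<le> n\<close> \<open>coeff d n = 0\<close> d by (metis leading_coeff_0_iff le_zero_eq)
qed

text \<open>As a function of the last point, the determinant is a polynomial whose leading coefficient is the
  determinant for the remaining points and which vanishes at all other points, because two rows then
  coincide. Since the points are distinct, these zeros determine it.\<close>
theorem det_monic_polys:
  fixes P :: "nat \<Rightarrow> 'a::idom poly" and x :: "nat \<Rightarrow> 'a"
  assumes P: "\<And>n. degree (P n) = n" "\<And>n. lead_coeff (P n) = 1"
    and inj: "inj_on x {..<N}"
  shows "det (mat N N (\<lambda>(i, j). poly (P j) (x i))) = (\<Prod>i<N. \<Prod>k<i. (x i - x k))"
  using inj
proof (induction N)
  case 0
  then show ?case by (simp add: det_dim_zero)
next
  case (Suc N)
  define A where "A t = mat (Suc N) (Suc N) (\<lambda>(i, j). poly (P j) (if i = N then t else x i))" for t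
  define C where "C j = cofactor (A 0) N j" for j
  have Adim: "A t \<in> carrier_mat (Suc N) (Suc N)" for t by (simp add: A_def)
  have cof: "cofactor (A t) N j = C j" if "j < Suc N" for t j
  proof -
    have "mat_delete (A t) N j = mat_delete (A 0) N j"
      using that by (intro eq_matI) (auto simp: mat_delete_def A_def)
    then show ?thesis by (simp add: C_def cofactor_def)
  qed
  define q where "q = (\<Sum>j<Suc N. Polynomial.smult (C j) (P j))"
  \<comment> \<open>Laplace expansion along the row of the moving point: its cofactors do not depend on \<open>t\<close>.\<close>
  have q: "poly q t = det (A t)" for t
  proof -
    have "det (A t) = (\<Sum>j<Suc N. A t $$ (N, j) * cofactor (A t) N j)"
      by (rule laplace_expansion_row[OF Adim]) simp
    also have "\<dots> = poly q t"
      using cof by (auto simp: q_def poly_sum A_def mult.commute simp del: sum.lessThan_Suc intro!: sum.cong)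
    finally show ?thesis ..
  qed
  have deg: "degree q \<le> N"
    unfolding q_def using P(1) by (intro degree_sum_le) (auto intro: order.trans[OF degree_smult_le])
  have CN: "C N = det (mat N N (\<lambda>(i, j). poly (P j) (x i)))"
  proof -
    have "mat_delete (A 0) N N = mat N N (\<lambda>(i, j). poly (P j) (x i))"
      by (intro eq_matI) (auto simp: mat_delete_def A_def)
    then show ?thesis by (simp add: C_def cofactor_def)
  qed
  have "coeff q N = C N"
  proof -
    have "coeff q N = (\<Sum>j<Suc N. C j * coeff (P j) N)" by (simp add: q_def coeff_sum)
    also have "\<dots> = (\<Sum>j<N. C j * coeff (P j) N) + C N" using P[of N] by simp
    also have "(\<Sum>j<N. C j * coeff (P j) N) = 0"
      using P(1) by (intro sum.neutral) (auto intro!: coeff_eq_0)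
    finally show ?thesis by simp
  qed
  moreover have "poly q (x i) = 0" if "i < N" for i
    unfolding q
    by (rule det_identical_rows[OF Adim, of i N]) (use that in \<open>auto simp: A_def row_def\<close>)
  moreover have inj': "inj_on x {..<N}" using Suc.prems by (auto simp: inj_on_def)
  ultimately have "q = Polynomial.smult (C N) (\<Prod>i<N. [:- x i, 1:])"
    using poly_eq_leading_coeff_prod_roots[OF deg inj'] by simp
  then have "poly q (x N) = C N * (\<Prod>k<N. (x N - x k))"
    by (simp add: poly_prod)
  moreover have "A (x N) = mat (Suc N) (Suc N) (\<lambda>(i, j). poly (P j) (x i))"
    by (intro eq_matI) (auto simp: A_def)
  ultimately show ?case using q[of "x N"] CN Suc.IH[OF inj'] by simp
qed

section \<open>Integrals of squared Slater determinants\<close>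

text \<open>In the expansion of a squared Slater determinant the particle \<open>j\<close> is left unintegrated, so
  orthogonality only shows that two permutations agree at the other particles.\<close>
lemma permutes_eq_if_agree_off_point:
  assumes \<sigma>: "\<sigma> permutes S" and \<tau>: "\<tau> permutes S" and agree: "\<And>i. i \<in> S \<Longrightarrow> i \<noteq> j \<Longrightarrow> \<sigma> i = \<tau> i"
  shows "\<sigma> = \<tau>"
proof
  have off: "\<sigma> i = \<tau> i" if "i \<noteq> j" for i
    using that agree \<sigma> \<tau> by (cases "i \<in> S") (auto simp: permutes_def)
  fix i show "\<sigma> i = \<tau> i"
  proof (cases "i = j")
    case False then show ?thesis by (rule off)
  next
    case True
    obtain l where l: "\<tau> l = \<sigma> j" using \<tau> by (metis permutes_surj surjD)
    show ?thesis
    proof (rule ccontr)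
      assume "\<sigma> i \<noteq> \<tau> i"
      then have "l \<noteq> j" using l True by auto
      then have "\<sigma> l = \<sigma> j" using l off by simp
      then show False using \<open>l \<noteq> j\<close> \<sigma> by (metis injD permutes_inj)
    qed
  qed
qed

definition slater :: "(nat \<Rightarrow> 'a \<Rightarrow> complex) \<Rightarrow> nat \<Rightarrow> (nat \<Rightarrow> 'a) \<Rightarrow> complex" where
  "slater \<phi> N x = det (mat N N (\<lambda>(i, j). \<phi> j (x i)))"

lemma slater_expand:
  "slater \<phi> N x = (\<Sum>\<sigma> | \<sigma> permutes {..<N}. signof \<sigma> * (\<Prod>i<N. \<phi> (\<sigma> i) (x i)))"
  unfolding slater_def
  by (subst det_def'[of _ N]) (auto simp: lessThan_atLeast0 intro!: sum.cong prod.cong permutes_in_image dest: permutes_in_image)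

lemma sum_permutations_sum_apply:
  fixes b :: "nat \<Rightarrow> real"
  shows "(\<Sum>\<sigma> | \<sigma> permutes {..<N}. \<Sum>j<N. b (\<sigma> j)) = fact N * (\<Sum>k<N. b k)"
proof -
  have "(\<Sum>j<N. b (\<sigma> j)) = (\<Sum>k<N. b k)" if "\<sigma> permutes {..<N}" for \<sigma>
    using sum.permute[OF that, of b] by (simp add: o_def)
  then show ?thesis by (simp add: card_permutations of_nat_fact)
qed

text \<open>Expand both determinants over permutations and integrate each product coordinatewise. Orthonormality
  of the coordinates other than \<open>j\<close> kills every pair of distinct permutations, and the diagonal terms
  visit each level \<open>k\<close> equally often as \<open>j\<close> and the permutation vary.\<close>
theorem slater_one_point_integral:
  fixes M :: "'a measure" and \<phi> :: "nat \<Rightarrow> 'a \<Rightarrow> complex"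
  assumes M: "sigma_finite_measure M" and meas: "\<And>k. \<phi> k \<in> borel_measurable M"
    and int: "\<And>k l. k < N \<Longrightarrow> l < N \<Longrightarrow> integrable M (\<lambda>x. \<phi> k x * cnj (\<phi> l x))"
    and orth: "\<And>k l. k < N \<Longrightarrow> l < N \<Longrightarrow> (\<integral>x. \<phi> k x * cnj (\<phi> l x) \<partial>M) = (if k = l then 1 else 0)"
    and B: "B \<in> sets M"
  shows "has_bochner_integral (Pi\<^sub>M {..<N} (\<lambda>_. M))
     (\<lambda>x. (\<Sum>j<N. indicator B (x j)) * (cmod (slater \<phi> N x))\<^sup>2)
     (fact N * (\<Sum>k<N. \<integral>x. indicator B x * (cmod (\<phi> k x))\<^sup>2 \<partial>M))"
proof -
  interpret M: sigma_finite_measure M by (rule M)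
  interpret P: product_sigma_finite "\<lambda>_::nat. M" by standard
  define S where "S = {\<sigma>. \<sigma> permutes {..<N}}"
  have fS: "finite S" by (simp add: S_def finite_permutations)
  have inS: "\<sigma> i < N" if "\<sigma> \<in> S" "i < N" for \<sigma> i
    using that permutes_in_image[of \<sigma> "{..<N}" i] by (auto simp: S_def)
  define g where "g \<sigma> \<tau> j i x = (if i = j then indicator B x else 1) * (\<phi> (\<sigma> i) x * cnj (\<phi> (\<tau> i) x))"
    for \<sigma> \<tau> :: "nat \<Rightarrow> nat" and j i x
  define b where "b k = (\<integral>x. indicator B x * (cmod (\<phi> k x))\<^sup>2 \<partial>M)" for k
  have intB: "integrable M (\<lambda>x. indicator B x * (\<phi> k x * cnj (\<phi> l x)))" if "k < N" "l < N" for k l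
  proof -
    have "(\<lambda>x. indicator B x * (\<phi> k x * cnj (\<phi> l x))) = (\<lambda>x. indicat_real B x *\<^sub>R (\<phi> k x * cnj (\<phi> l x)))"
      by (auto simp: indicator_def)
    then show ?thesis using integrable_mult_indicator[OF B int[OF that]] by simp
  qed
  have intg: "integrable M (g \<sigma> \<tau> j i)" if "\<sigma> \<in> S" "\<tau> \<in> S" "i < N" for \<sigma> \<tau> j i
    using that intB int inS unfolding g_def by (cases "i = j") auto
  have off: "(\<Prod>i<N. \<integral>x. g \<sigma> \<tau> j i x \<partial>M) = 0" if "\<sigma> \<in> S" "\<tau> \<in> S" "\<sigma> \<noteq> \<tau>" for \<sigma> \<tau> j
  proof -
    have "\<exists>i<N. i \<noteq> j \<and> \<sigma> i \<noteq> \<tau> i"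
      using permutes_eq_if_agree_off_point[of \<sigma> "{..<N}" \<tau> j] that by (auto simp: S_def)
    then obtain i where "i < N" "i \<noteq> j" "\<sigma> i \<noteq> \<tau> i" by blast
    then have "(\<integral>x. g \<sigma> \<tau> j i x \<partial>M) = 0" using orth inS that by (simp add: g_def)
    then show ?thesis using \<open>i < N\<close> by (auto intro!: prod_zero)
  qed
  have diag: "(\<Prod>i<N. \<integral>x. g \<sigma> \<sigma> j i x \<partial>M) = of_real (b (\<sigma> j))" if "\<sigma> \<in> S" "j < N" for \<sigma> j
  proof -
    have "(\<integral>x. g \<sigma> \<sigma> j i x \<partial>M) = (if i = j then of_real (b (\<sigma> j)) else 1)" if "i < N" for i
    proof (cases "i = j")
      case True
      have "g \<sigma> \<sigma> j j x = of_real (indicator B x * (cmod (\<phi> (\<sigma> j) x))\<^sup>2)" for x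
        by (simp add: g_def flip: complex_norm_square) (simp add: indicator_def)
      then show ?thesis using True by (simp add: b_def flip: integral_complex_of_real)
    next
      case False
      then show ?thesis using orth[of "\<sigma> i" "\<sigma> i"] inS \<open>\<sigma> \<in> S\<close> \<open>i < N\<close> by (simp add: g_def)
    qed
    then have "(\<Prod>i<N. \<integral>x. g \<sigma> \<sigma> j i x \<partial>M) = (\<Prod>i<N. if i = j then of_real (b (\<sigma> j)) else 1)"
      by (intro prod.cong) auto
    then show ?thesis using \<open>j < N\<close> by (simp add: prod.delta)
  qed
  have expand: "of_real ((\<Sum>j<N. indicator B (x j)) * (cmod (slater \<phi> N x))\<^sup>2) =
     (\<Sum>j<N. \<Sum>\<sigma>\<in>S. \<Sum>\<tau>\<in>S. signof \<sigma> * signof \<tau> * (\<Prod>i<N. g \<sigma> \<tau> j i (x i)))" for x :: "nat \<Rightarrow> 'a"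
  proof -
    have "of_real ((cmod (slater \<phi> N x))\<^sup>2) = slater \<phi> N x * cnj (slater \<phi> N x)"
      by (rule complex_norm_square)
    also have "\<dots> = (\<Sum>\<sigma>\<in>S. \<Sum>\<tau>\<in>S. signof \<sigma> * signof \<tau> * (\<Prod>i<N. \<phi> (\<sigma> i) (x i) * cnj (\<phi> (\<tau> i) (x i))))"
      by (simp add: slater_expand S_def[symmetric] sum_product prod.distrib sign_def mult_ac)
    finally have sq: "complex_of_real ((cmod (slater \<phi> N x))\<^sup>2) = \<dots>" .
    have split: "(\<Prod>i<N. g \<sigma> \<tau> j i (x i)) = indicator B (x j) * (\<Prod>i<N. \<phi> (\<sigma> i) (x i) * cnj (\<phi> (\<tau> i) (x i)))"
      if "j < N" for \<sigma> \<tau> j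
    proof -
      have "(\<Prod>i<N. g \<sigma> \<tau> j i (x i)) = (\<Prod>i<N. if i = j then indicator B (x j) else 1) * (\<Prod>i<N. \<phi> (\<sigma> i) (x i) * cnj (\<phi> (\<tau> i) (x i)))"
        unfolding g_def prod.distrib by (intro arg_cong2[of _ _ _ _ "(*)"] prod.cong) auto
      then show ?thesis using that by (simp add: prod.delta)
    qed
    have ind: "of_real (\<Sum>j<N. indicator B (x j)) = (\<Sum>j<N. indicator B (x j) :: complex)"
      unfolding of_real_sum by (intro sum.cong) (auto simp: indicator_def)
    show ?thesis
      unfolding of_real_mult sq ind
      by (subst sum_distrib_right) (intro sum.cong refl, simp add: sum_distrib_left split mult_ac)
  qed
  have "has_bochner_integral (Pi\<^sub>M {..<N} (\<lambda>_. M))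
     (\<lambda>x. \<Sum>j<N. \<Sum>\<sigma>\<in>S. \<Sum>\<tau>\<in>S. signof \<sigma> * signof \<tau> * (\<Prod>i<N. g \<sigma> \<tau> j i (x i)))
     (\<Sum>j<N. \<Sum>\<sigma>\<in>S. \<Sum>\<tau>\<in>S. signof \<sigma> * signof \<tau> * (\<Prod>i<N. \<integral>x. g \<sigma> \<tau> j i x \<partial>M))"
  proof (intro has_bochner_integral_sum has_bochner_integral_mult_right)
    fix j \<sigma> \<tau> assume "\<sigma> \<in> S" "\<tau> \<in> S"
    then show "has_bochner_integral (Pi\<^sub>M {..<N} (\<lambda>_. M)) (\<lambda>x. \<Prod>i<N. g \<sigma> \<tau> j i (x i)) (\<Prod>i<N. \<integral>x. g \<sigma> \<tau> j i x \<partial>M)"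
      using P.product_integral_prod[of "{..<N}" "g \<sigma> \<tau> j"] P.product_integrable_prod[of "{..<N}" "g \<sigma> \<tau> j"] intg
      by (auto simp: has_bochner_integral_iff)
  qed
  also have "(\<Sum>j<N. \<Sum>\<sigma>\<in>S. \<Sum>\<tau>\<in>S. signof \<sigma> * signof \<tau> * (\<Prod>i<N. \<integral>x. g \<sigma> \<tau> j i x \<partial>M)) =
     (\<Sum>j<N. \<Sum>\<sigma>\<in>S. \<Sum>\<tau>\<in>S. if \<tau> = \<sigma> then of_real (b (\<sigma> j)) else 0)"
    using off diag by (intro sum.cong) (auto simp: sign_def)
  also have "\<dots> = of_real (\<Sum>\<sigma>\<in>S. \<Sum>j<N. b (\<sigma> j))"
    using fS by (subst sum.swap) (simp add: sum.delta)
  also have "(\<Sum>\<sigma>\<in>S. \<Sum>j<N. b (\<sigma> j)) = fact N * (\<Sum>k<N. b k)"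
    unfolding S_def by (rule sum_permutations_sum_apply)
  finally have "has_bochner_integral (Pi\<^sub>M {..<N} (\<lambda>_. M))
     (\<lambda>x. complex_of_real ((\<Sum>j<N. indicator B (x j)) * (cmod (slater \<phi> N x))\<^sup>2)) (of_real (fact N * (\<Sum>k<N. b k)))"
    unfolding expand .
  from has_bochner_integral_Re[OF this] show ?thesis by (simp add: b_def)
qed

text \<open>Fubini in one of two coinciding coordinates: for the other coordinates fixed, a coincidence
  restricts it to a single point.\<close>
lemma AE_PiM_inj:
  assumes M: "sigma_finite_measure M" and I: "finite I"
    and sing: "\<And>a. a \<in> space M \<Longrightarrow> {a} \<in> null_sets M"
    and diag: "{z \<in> space (M \<Otimes>\<^sub>M M). fst z = snd z} \<in> sets (M \<Otimes>\<^sub>M M)"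
  shows "AE x in Pi\<^sub>M I (\<lambda>_. M). inj_on x I"
proof -
  interpret M: sigma_finite_measure M by (rule M)
  interpret P: product_sigma_finite "\<lambda>_. M" by standard
  have "AE x in Pi\<^sub>M I (\<lambda>_. M). x j \<noteq> x k" if jk: "j \<in> I" "k \<in> I" "j \<noteq> k" for j k
  proof -
    let ?P = "Pi\<^sub>M I (\<lambda>_. M)"
    define J where "J = I - {k}"
    have J: "I = insert k J" "finite J" "k \<notin> J" "j \<in> J" using jk I by (auto simp: J_def)
    define E where "E = {x \<in> space ?P. x j = x k}"
    have "(\<lambda>x. (x j, x k)) \<in> measurable ?P (M \<Otimes>\<^sub>M M)"
      using jk by (intro measurable_Pair measurable_component_singleton) auto
    from measurable_sets[OF this diag]
    have "(\<lambda>x. (x j, x k)) -` {z \<in> space (M \<Otimes>\<^sub>M M). fst z = snd z} \<inter> space ?P \<in> sets ?P" .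
    also have "(\<lambda>x. (x j, x k)) -` {z \<in> space (M \<Otimes>\<^sub>M M). fst z = snd z} \<inter> space ?P = E"
      using jk by (auto simp: E_def space_pair_measure space_PiM PiE_iff extensional_def)
    finally have E: "E \<in> sets ?P" .
    have "emeasure ?P E = (\<integral>\<^sup>+x. indicator E x \<partial>?P)" using E by simp
    also have "\<dots> = (\<integral>\<^sup>+x. \<integral>\<^sup>+y. indicator E (x(k := y)) \<partial>M \<partial>Pi\<^sub>M J (\<lambda>_. M))"
      using E J P.product_nn_integral_insert[of J k "indicator E"] by simp
    also have "\<dots> = (\<integral>\<^sup>+x. 0 \<partial>Pi\<^sub>M J (\<lambda>_. M))"
    proof (rule nn_integral_cong)
      fix x assume x: "x \<in> space (Pi\<^sub>M J (\<lambda>_. M))"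
      have xj: "x j \<in> space M" using x J by (auto simp: space_PiM)
      have "(\<integral>\<^sup>+y. indicator E (x(k := y)) \<partial>M) \<le> (\<integral>\<^sup>+y. indicator {x j} y \<partial>M)"
        using jk by (intro nn_integral_mono) (auto simp: E_def indicator_def)
      also have "\<dots> = 0" using sing[OF xj] by (auto simp: null_sets_def)
      finally show "(\<integral>\<^sup>+y. indicator E (x(k := y)) \<partial>M) = 0" by simp
    qed
    finally have "E \<in> null_sets ?P" using E by auto
    then show ?thesis by (rule AE_I') (auto simp: E_def)
  qed
  then have "AE x in Pi\<^sub>M I (\<lambda>_. M). \<forall>j\<in>I. \<forall>k\<in>I. j \<noteq> k \<longrightarrow> x j \<noteq> x k"
    using I by (intro AE_finite_allI) auto
  then show ?thesis by eventually_elim (auto simp: inj_on_def)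
qed

section \<open>The 1-point function of a planar determinantal ensemble\<close>

lemma space_area_measure [simp]: "space area_measure = UNIV"
  and sets_area_measure [simp, measurable_cong]: "sets area_measure = sets borel"
  by (simp_all add: area_measure_def)

lemma emeasure_area_measure: "A \<in> sets borel \<Longrightarrow> emeasure area_measure A = ennreal (1 / pi) * emeasure lborel A"
  by (simp add: area_measure_def emeasure_density nn_integral_cmult)

lemma sigma_finite_area_measure: "sigma_finite_measure area_measure"
  unfolding area_measure_def
  by (subst sigma_finite_measure.sigma_finite_iff_density_finite[OF sigma_finite_lborel]) auto

lemma area_measure_ball: "r \<ge> 0 \<Longrightarrow> measure area_measure (ball w r) = r\<^sup>2" "r \<ge> 0 \<Longrightarrow> emeasure area_measure (ball w r) = ennreal (r\<^sup>2)"
proof -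
  show e: "emeasure area_measure (ball w r) = ennreal (r\<^sup>2)" if "r \<ge> 0"
    using that by (simp add: emeasure_area_measure emeasure_ball unit_ball_vol_2 flip: ennreal_mult)
  then show "measure area_measure (ball w r) = r\<^sup>2" if "r \<ge> 0"
    using that by (simp add: measure_def)
qed

text \<open>With the normalisation of \<open>area_measure\<close> a disc of radius \<open>\<epsilon>\<close> has mass \<open>\<epsilon>\<^sup>2\<close>, so
  the quotient is an average of \<open>f\<close> over the disc.\<close>
lemma tendsto_area_ball_average:
  fixes f :: "complex \<Rightarrow> real"
  assumes cont: "continuous_on UNIV f"
  shows "((\<lambda>\<epsilon>. (\<integral>x. indicator (ball w \<epsilon>) x * f x \<partial>area_measure) / \<epsilon>\<^sup>2) \<longlongrightarrow> f w) (at_right 0)"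
proof (rule tendstoI)
  fix e :: real assume "e > 0"
  then have e: "e / 2 > 0" by simp
  obtain d where d: "d > 0" "\<And>x. dist x w < d \<Longrightarrow> \<bar>f x - f w\<bar> < e / 2"
    using cont[unfolded continuous_on_iff, rule_format, of w, OF UNIV_I e] by (auto simp: dist_real_def)
  have [measurable]: "f \<in> borel_measurable borel" using cont by (rule borel_measurable_continuous_onI)
  show "\<forall>\<^sub>F \<epsilon> in at_right 0. dist ((\<integral>x. indicator (ball w \<epsilon>) x * f x \<partial>area_measure) / \<epsilon>\<^sup>2) (f w) < e"
    using eventually_at_right_real[OF d(1)]
  proof eventually_elim
    case (elim \<epsilon>)
    then have \<epsilon>: "0 < \<epsilon>" "\<epsilon> < d" by auto
    let ?I = "\<lambda>x. indicator (ball w \<epsilon>) x :: real"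
    have bint: "integrable area_measure (\<lambda>x. ?I x * g x)" if [measurable]: "g \<in> borel_measurable borel"
      and b: "\<And>x. x \<in> ball w \<epsilon> \<Longrightarrow> \<bar>g x\<bar> \<le> B" for g B
    proof (rule Bochner_Integration.integrable_bound)
      show "integrable area_measure (\<lambda>x. B * ?I x)"
        using area_measure_ball(2)[of \<epsilon> w] \<epsilon> by (intro integrable_mult_right integrable_real_indicator) auto
      show "AE x in area_measure. norm (?I x * g x) \<le> norm (B * ?I x)"
        using b by (auto simp: indicator_def abs_mult intro: order_trans[OF _ abs_ge_self])
      show "(\<lambda>x. ?I x * g x) \<in> borel_measurable area_measure"
        by (subst measurable_cong_sets[OF sets_area_measure refl])
           (intro borel_measurable_times borel_measurable_indicator that(1), simp)
    qed
    have bound: "\<bar>f x - f w\<bar> \<le> e / 2" if "x \<in> ball w \<epsilon>" for x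
      using that d(2)[of x] \<epsilon> by (auto simp: dist_commute intro: less_imp_le)
    have i1: "integrable area_measure (\<lambda>x. ?I x * (f x - f w))" by (rule bint[OF _ bound]) simp_all
    have i2: "integrable area_measure (\<lambda>x. ?I x * f w)" by (rule bint[of _ "\<bar>f w\<bar>"]) simp_all
    have i3: "integrable area_measure (\<lambda>x. ?I x * (e / 2))" by (rule bint[of _ "\<bar>e / 2\<bar>"]) simp_all
    have "(\<integral>x. ?I x * f x \<partial>area_measure) = (\<integral>x. ?I x * (f x - f w) + ?I x * f w \<partial>area_measure)"
      by (simp add: algebra_simps)
    also have "\<dots> = (\<integral>x. ?I x * (f x - f w) \<partial>area_measure) + (\<integral>x. ?I x * f w \<partial>area_measure)"
      by (rule Bochner_Integration.integral_add[OF i1 i2])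
    also have "(\<integral>x. ?I x * f w \<partial>area_measure) = \<epsilon>\<^sup>2 * f w"
      using area_measure_ball(1)[of \<epsilon> w] \<epsilon> by simp
    finally have eq: "(\<integral>x. ?I x * f x \<partial>area_measure) / \<epsilon>\<^sup>2 - f w = (\<integral>x. ?I x * (f x - f w) \<partial>area_measure) / \<epsilon>\<^sup>2"
      using \<epsilon> by (simp add: field_simps)
    have "\<bar>\<integral>x. ?I x * (f x - f w) \<partial>area_measure\<bar> \<le> (\<integral>x. \<bar>?I x * (f x - f w)\<bar> \<partial>area_measure)"
      by (rule integral_abs_bound)
    also have "\<dots> \<le> (\<integral>x. ?I x * (e / 2) \<partial>area_measure)"
      using i1 i3 bound by (intro integral_mono integrable_abs) (auto simp: indicator_def)
    also have "\<dots> = \<epsilon>\<^sup>2 * (e / 2)"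
      using area_measure_ball(1)[of \<epsilon> w] \<epsilon> by simp
    finally have "\<bar>(\<integral>x. ?I x * (f x - f w) \<partial>area_measure) / \<epsilon>\<^sup>2\<bar> \<le> e / 2"
      using \<epsilon> by (simp add: abs_divide field_simps)
    then show ?case unfolding dist_real_def eq using \<open>e > 0\<close> by linarith
  qed
qed

lemma slater_scale:
  "slater (\<lambda>k z. c k * u z * h k z) N x = (\<Prod>k<N. c k) * (\<Prod>i<N. u (x i)) * slater h N x"
proof -
  have "(\<Prod>i<N. c (\<sigma> i)) = (\<Prod>k<N. c k)" if "\<sigma> permutes {..<N}" for \<sigma>
    using prod.permute[OF that, of c] by (simp add: o_def)
  then show ?thesis
    by (simp add: slater_expand prod.distrib sum_distrib_left mult_ac)
qed

text \<open>Injectivity matters here: at coinciding points \<open>ln (1 / 0) = 0\<close> contributes the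
  factor \<open>1\<close> on the left, while the right-hand side vanishes.\<close>
lemma exp_neg_hamiltonian:
  assumes "inj_on \<zeta> {..<N}"
  shows "exp (- hamiltonian N Q \<zeta>) =
    (\<Prod>i<N. \<Prod>k<i. (cmod (\<zeta> i - \<zeta> k))\<^sup>2) * (\<Prod>i<N. exp (- real N * Q (\<zeta> i)))"
proof -
  define T where "T = (SIGMA i:{..<N}. {..<i})"
  have fT: "finite T" by (simp add: T_def)
  have split: "{(j, k). j < N \<and> k < N \<and> j \<noteq> k} = T \<union> prod.swap ` T"
    by (auto simp: T_def image_iff)
  have disj: "T \<inter> prod.swap ` T = {}" by (auto simp: T_def)
  have inj: "inj_on prod.swap T" by simp
  have ne: "\<zeta> j \<noteq> \<zeta> k" if "(j, k) \<in> T \<union> prod.swap ` T" for j k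
    using that assms unfolding split[symmetric] by (auto simp: inj_on_def)
  have "exp (- (\<Sum>(j, k) \<in> T \<union> prod.swap ` T. ln (1 / cmod (\<zeta> j - \<zeta> k)))) =
     (\<Prod>(j, k) \<in> T \<union> prod.swap ` T. cmod (\<zeta> j - \<zeta> k))"
    unfolding sum_negf[symmetric] using fT ne
    by (subst exp_sum) (auto simp: case_prod_unfold ln_div intro!: prod.cong)
  also have "\<dots> = (\<Prod>(j, k) \<in> T. cmod (\<zeta> j - \<zeta> k)) * (\<Prod>(j, k) \<in> T. cmod (\<zeta> k - \<zeta> j))"
    using fT disj by (subst prod.union_disjoint) (auto simp: prod.reindex[OF inj] case_prod_unfold)
  also have "\<dots> = (\<Prod>(j, k) \<in> T. (cmod (\<zeta> j - \<zeta> k))\<^sup>2)"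
    by (simp add: norm_minus_commute power2_eq_square case_prod_unfold flip: prod.distrib)
  also have "\<dots> = (\<Prod>i<N. \<Prod>k<i. (cmod (\<zeta> i - \<zeta> k))\<^sup>2)"
    unfolding T_def by (rule prod.Sigma[symmetric]) auto
  finally have "exp (- (\<Sum>(j, k) \<in> T \<union> prod.swap ` T. ln (1 / cmod (\<zeta> j - \<zeta> k)))) = \<dots>" .
  moreover have "exp (- (real N * (\<Sum>j<N. Q (\<zeta> j)))) = (\<Prod>i<N. exp (- real N * Q (\<zeta> i)))"
    by (subst exp_sum[symmetric]) (simp_all add: sum_distrib_left sum_negf)
  ultimately show ?thesis
    unfolding hamiltonian_def split minus_add_distrib exp_add by simp
qed

lemma AE_area_measure_pow_inj: "AE \<zeta> in area_measure_pow N. inj_on \<zeta> {..<N}"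
  unfolding area_measure_pow_def
proof (rule AE_PiM_inj[OF sigma_finite_area_measure])
  show "{a} \<in> null_sets area_measure" for a :: complex
    by (simp add: null_sets_def emeasure_area_measure)
  have "{z :: complex \<times> complex. fst z = snd z} \<in> sets borel"
    by (intro borel_closed closed_Collect_eq continuous_intros)
  moreover have "sets (area_measure \<Otimes>\<^sub>M area_measure) = sets (borel :: (complex \<times> complex) measure)"
    by (metis borel_prod sets_area_measure sets_pair_measure_cong)
  ultimately show "{z \<in> space (area_measure \<Otimes>\<^sub>M area_measure). fst z = snd z} \<in> sets (area_measure \<Otimes>\<^sub>M area_measure)"
    by (simp add: space_pair_measure)
qed simp

lemma borel_measurable_hamiltonian:
  assumes [measurable]: "Q \<in> borel_measurable borel"
  shows "hamiltonian N Q \<in> borel_measurable (area_measure_pow N)"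
proof -
  have comp[measurable]: "(\<lambda>\<zeta>. \<zeta> i) \<in> borel_measurable (area_measure_pow N)" if "i < N" for i
    using measurable_component_singleton[of i "{..<N}" "\<lambda>_. area_measure"] that
    by (simp add: area_measure_pow_def cong: measurable_cong_sets)
  show ?thesis
    unfolding hamiltonian_def
    by (intro borel_measurable_add borel_measurable_times borel_measurable_sum borel_measurable_const)
       (auto intro!: borel_measurable_ln borel_measurable_divide borel_measurable_norm borel_measurable_diff comp
          measurable_compose[OF comp assms])
qed

text \<open>The Gibbs density is almost everywhere a constant times the squared Slater determinant of the
  orthonormal functions \<open>\<phi> k = P k exp (- N Q / 2) / sqrt (\<nu> k)\<close>. The constant is recovered by counting
  all particles, and the expected number of particles in a disc, divided by the mass of the disc,
  tends to the continuous density \<open>\<Sum>k<N. \<bar>\<phi> k\<bar>\<^sup>2\<close>.\<close>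
theorem one_point_function_orthogonal_polynomials:
  fixes P :: "nat \<Rightarrow> complex poly" and Q :: "complex \<Rightarrow> real"
  assumes Q: "continuous_on UNIV Q" and N: "N > 0"
    and monic: "\<And>n. degree (P n) = n" "\<And>n. lead_coeff (P n) = 1"
    and int: "\<And>k l. integrable area_measure (\<lambda>z. of_real (exp (- real N * Q z)) * (poly (P k) z * cnj (poly (P l) z)))"
    and orth: "\<And>k l. (\<integral>z. of_real (exp (- real N * Q z)) * (poly (P k) z * cnj (poly (P l) z)) \<partial>area_measure)
       = (if k = l then of_real (\<nu> k) else 0)"
    and \<nu>: "\<And>k. \<nu> k > 0"
  shows "one_point_function N Q w = (\<Sum>k<N. (cmod (poly (P k) w))\<^sup>2 / \<nu> k) * exp (- real N * Q w)"
proof -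
  define u where "u z = complex_of_real (exp (- real N * Q z / 2))" for z
  define \<phi> where "\<phi> k z = complex_of_real (1 / sqrt (\<nu> k)) * u z * poly (P k) z" for k z
  have Qm[measurable]: "Q \<in> borel_measurable borel" using Q by (rule borel_measurable_continuous_onI)
  have cont_\<phi>: "continuous_on UNIV (\<phi> k)" for k
    unfolding \<phi>_def u_def by (intro continuous_intros Q) simp_all
  have meas: "\<phi> k \<in> borel_measurable area_measure" for k
    using borel_measurable_continuous_onI[OF cont_\<phi>[of k]] by (simp cong: measurable_cong_sets)
  have uu: "u z * cnj (u z) = of_real (exp (- real N * Q z))" for z
    by (simp add: u_def flip: of_real_mult exp_add)
  have \<phi>\<phi>: "\<phi> k z * cnj (\<phi> l z) = of_real (1 / (sqrt (\<nu> k) * sqrt (\<nu> l))) *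
      (of_real (exp (- real N * Q z)) * (poly (P k) z * cnj (poly (P l) z)))" for k l z
    unfolding uu[symmetric] \<phi>_def by (simp add: mult_ac)
  have \<phi>2: "(cmod (\<phi> k z))\<^sup>2 = (cmod (poly (P k) z))\<^sup>2 / \<nu> k * exp (- real N * Q z)" for k z
  proof -
    have "(exp (- real N * Q z / 2))\<^sup>2 = exp (- real N * Q z)"
      by (simp add: power2_eq_square flip: exp_add)
    then show ?thesis using \<nu>[of k]
      by (simp add: \<phi>_def u_def norm_mult norm_divide power_mult_distrib power_divide)
  qed
  have one_point: "has_bochner_integral (area_measure_pow N)
     (\<lambda>x. (\<Sum>j<N. indicator B (x j)) * (cmod (slater \<phi> N x))\<^sup>2)
     (fact N * (\<Sum>k<N. \<integral>x. indicator B x * (cmod (\<phi> k x))\<^sup>2 \<partial>area_measure))" if "B \<in> sets borel" for B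
    unfolding area_measure_pow_def
  proof (rule slater_one_point_integral[OF sigma_finite_area_measure meas])
    show "integrable area_measure (\<lambda>x. \<phi> k x * cnj (\<phi> l x))" for k l
      unfolding \<phi>\<phi> by (rule integrable_mult_right[OF int])
    show "(\<integral>x. \<phi> k x * cnj (\<phi> l x) \<partial>area_measure) = (if k = l then 1 else 0)" for k l
      unfolding \<phi>\<phi> integral_mult_right_zero orth using \<nu>[of k] by (auto simp flip: of_real_mult)
  qed (use that in simp)
  define C where "C = (\<Prod>k<N. \<nu> k)"
  have C: "C > 0" unfolding C_def by (intro prod_pos) (simp add: \<nu>)
  have density: "exp (- hamiltonian N Q x) = C * (cmod (slater \<phi> N x))\<^sup>2" if "inj_on x {..<N}" for x
  proof -
    have V: "slater (\<lambda>k. poly (P k)) N x = (\<Prod>i<N. \<Prod>k<i. (x i - x k))"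
      unfolding slater_def by (rule det_monic_polys[OF monic that])
    have "slater \<phi> N x = (\<Prod>k<N. complex_of_real (1 / sqrt (\<nu> k))) * (\<Prod>i<N. u (x i)) * (\<Prod>i<N. \<Prod>k<i. (x i - x k))"
      unfolding \<phi>_def slater_scale V ..
    moreover have norm_\<nu>: "cmod (complex_of_real (1 / sqrt (\<nu> k))) = 1 / sqrt (\<nu> k)" for k
      using less_imp_le[OF \<nu>[of k]] by (simp add: norm_divide)
    ultimately have "(cmod (slater \<phi> N x))\<^sup>2 = (\<Prod>k<N. (1 / sqrt (\<nu> k))\<^sup>2) * (\<Prod>i<N. (cmod (u (x i)))\<^sup>2)
         * (\<Prod>i<N. \<Prod>k<i. (cmod (x i - x k))\<^sup>2)"
      by (simp only: norm_mult power_mult_distrib prod_power_distrib norm_\<nu> flip: prod_norm)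
    also have "(\<Prod>k<N. (1 / sqrt (\<nu> k))\<^sup>2) = 1 / C"
      using \<nu> by (simp add: C_def power_divide prod_dividef less_imp_le)
    also have "(\<Prod>i<N. (cmod (u (x i)))\<^sup>2) = (\<Prod>i<N. exp (- real N * Q (x i)))"
      by (intro prod.cong) (auto simp: u_def power2_eq_square simp flip: exp_add)
    finally show ?thesis
      using C unfolding exp_neg_hamiltonian[OF that] by (simp add: field_simps)
  qed
  have AE_density: "AE x in area_measure_pow N. exp (- hamiltonian N Q x) = C * (cmod (slater \<phi> N x))\<^sup>2"
    using AE_area_measure_pow_inj by eventually_elim (rule density)
  note hm = borel_measurable_hamiltonian[OF Qm, of N]
  have comp: "(\<lambda>\<zeta>. \<zeta> i) \<in> borel_measurable (area_measure_pow N)" if "i < N" for i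
    using measurable_component_singleton[of i "{..<N}" "\<lambda>_. area_measure"] that
    by (simp add: area_measure_pow_def cong: measurable_cong_sets)
  have sm: "(\<lambda>x. \<Sum>j<N. indicat_real B (x j)) \<in> borel_measurable (area_measure_pow N)" if "B \<in> sets borel" for B
    using that by (intro borel_measurable_sum measurable_compose[OF comp borel_measurable_indicator]) auto
  have weighted: "(\<integral>x. (\<Sum>j<N. indicator B (x j)) * exp (- hamiltonian N Q x) \<partial>area_measure_pow N) =
     C * (fact N * (\<Sum>k<N. \<integral>x. indicator B x * (cmod (\<phi> k x))\<^sup>2 \<partial>area_measure))" if "B \<in> sets borel" for B
  proof -
    note hb = has_bochner_integral_mult_right[OF one_point[OF that], of C]
    have "(\<integral>x. (\<Sum>j<N. indicator B (x j)) * exp (- hamiltonian N Q x) \<partial>area_measure_pow N) =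
      (\<integral>x. C * ((\<Sum>j<N. indicator B (x j)) * (cmod (slater \<phi> N x))\<^sup>2) \<partial>area_measure_pow N)"
    proof (rule integral_cong_AE)
      show "AE x in area_measure_pow N. (\<Sum>j<N. indicator B (x j)) * exp (- hamiltonian N Q x) =
         C * ((\<Sum>j<N. indicator B (x j)) * (cmod (slater \<phi> N x))\<^sup>2)"
        using AE_density by eventually_elim (simp only: mult.left_commute)
      show "(\<lambda>x. (\<Sum>j<N. indicator B (x j)) * exp (- hamiltonian N Q x)) \<in> borel_measurable (area_measure_pow N)"
        using hm sm[OF that] by measurable
      show "(\<lambda>x. C * ((\<Sum>j<N. indicator B (x j)) * (cmod (slater \<phi> N x))\<^sup>2)) \<in> borel_measurable (area_measure_pow N)"
        using hb by (rule borel_measurable_has_bochner_integral)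
    qed
    then show ?thesis using has_bochner_integral_integral_eq[OF hb] by simp
  qed
  have norm1: "(\<integral>x. (cmod (\<phi> k x))\<^sup>2 \<partial>area_measure) = 1" for k
  proof -
    have "complex_of_real (\<integral>x. (cmod (\<phi> k x))\<^sup>2 \<partial>area_measure) = (\<integral>x. \<phi> k x * cnj (\<phi> k x) \<partial>area_measure)"
      by (simp add: complex_norm_square flip: integral_complex_of_real del: of_real_power)
    also have "\<dots> = 1"
      unfolding \<phi>\<phi> integral_mult_right_zero orth using \<nu>[of k] by (auto simp flip: of_real_mult)
    finally show ?thesis by (simp only: of_real_eq_1_iff)
  qed
  have Z: "partition_function N Q = C * fact N"
    using weighted[of UNIV] N by (simp add: partition_function_def norm1)
  have expected: "(\<integral>x. real (card {j \<in> {..<N}. x j \<in> B}) \<partial>gibbs_measure N Q) =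
     (\<Sum>k<N. \<integral>x. indicator B x * (cmod (\<phi> k x))\<^sup>2 \<partial>area_measure)" if "B \<in> sets borel" for B
  proof -
    have card: "real (card {j \<in> {..<N}. x j \<in> B}) = (\<Sum>j<N. indicator B (x j))" for x
    proof -
      have "{..<N} \<inter> {j. x j \<in> B} = {j \<in> {..<N}. x j \<in> B}" by auto
      then show ?thesis by (simp add: indicator_def of_bool_def sum.If_cases flip: sum.inter_filter)
    qed
    have "(\<integral>x. real (card {j \<in> {..<N}. x j \<in> B}) \<partial>gibbs_measure N Q) =
      (\<integral>x. (exp (- hamiltonian N Q x) / partition_function N Q) *\<^sub>R (\<Sum>j<N. indicator B (x j)) \<partial>area_measure_pow N)"
      unfolding gibbs_measure_def card
    proof (rule integral_density)
      show "(\<lambda>x. exp (- hamiltonian N Q x) / partition_function N Q) \<in> borel_measurable (area_measure_pow N)"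
        using hm by measurable
      show "AE x in area_measure_pow N. 0 \<le> exp (- hamiltonian N Q x) / partition_function N Q"
        unfolding Z using C by simp
    qed (rule sm[OF that])
    also have "\<dots> = (\<integral>x. (\<Sum>j<N. indicator B (x j)) * exp (- hamiltonian N Q x) \<partial>area_measure_pow N) / partition_function N Q"
      by (simp add: mult.commute flip: integral_divide_zero)
    also have "\<dots> = (\<Sum>k<N. \<integral>x. indicator B x * (cmod (\<phi> k x))\<^sup>2 \<partial>area_measure)"
      unfolding weighted[OF that] Z using C by simp
    finally show ?thesis .
  qed
  have "((\<lambda>\<epsilon>. (\<integral>\<zeta>. real (card {j \<in> {..<N}. \<zeta> j \<in> ball w \<epsilon>}) \<partial>gibbs_measure N Q) / \<epsilon>\<^sup>2)
      \<longlongrightarrow> (\<Sum>k<N. (cmod (\<phi> k w))\<^sup>2)) (at_right 0)"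
    unfolding expected[OF borel_open[OF open_ball]] sum_divide_distrib
    by (intro tendsto_sum tendsto_area_ball_average continuous_intros cont_\<phi>)
  then have "one_point_function N Q w = (\<Sum>k<N. (cmod (\<phi> k w))\<^sup>2)"
    unfolding one_point_function_def by (intro tendsto_Lim) simp_all
  then show ?thesis by (simp add: \<phi>2 sum_distrib_right)
qed

section \<open>Hermite polynomials and Mehler's formula\<close>

text \<open>For \<open>\<sigma> > 0\<close> these are the monic polynomials orthogonal for the centred normal law of variance \<open>\<sigma>\<close>,
  generated by the raising operator \<open>z - \<sigma> d/dz\<close>. For a planar Gaussian \<open>\<sigma>\<close> is a difference of two
  variances and may have either sign; \<open>\<sigma> = 0\<close> gives the monomials of the rotation invariant case.\<close>
fun hermite :: "'a::field_char_0 \<Rightarrow> nat \<Rightarrow> 'a poly" where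
  "hermite \<sigma> 0 = 1"
| "hermite \<sigma> (Suc n) = [:0, 1:] * hermite \<sigma> n - Polynomial.smult \<sigma> (pderiv (hermite \<sigma> n))"

lemma pderiv_hermite: "pderiv (hermite \<sigma> (Suc n)) = Polynomial.smult (of_nat (Suc n)) (hermite \<sigma> n)"
proof (induction n)
  case 0
  show ?case by (simp add: pderiv_pCons)
next
  case (Suc n)
  have "pderiv (hermite \<sigma> (Suc (Suc n))) = hermite \<sigma> (Suc n) +
     ([:0, 1:] * Polynomial.smult (of_nat (Suc n)) (hermite \<sigma> n) - Polynomial.smult \<sigma> (pderiv (Polynomial.smult (of_nat (Suc n)) (hermite \<sigma> n))))"
    by (subst hermite.simps(2)) (simp add: pderiv_mult pderiv_diff pderiv_smult pderiv_pCons Suc del: hermite.simps)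
  also have "\<dots> = hermite \<sigma> (Suc n) + Polynomial.smult (of_nat (Suc n)) (hermite \<sigma> (Suc n))"
    by (simp only: hermite.simps(2)[of \<sigma> n] pderiv_smult smult_diff_right mult_smult_right smult_smult
        mult.commute)
  also have "\<dots> = Polynomial.smult (of_nat (Suc (Suc n))) (hermite \<sigma> (Suc n))"
    by (simp only: of_nat_Suc[of "Suc n"] smult_add_left smult_1_left)
  finally show ?case .
qed

lemma poly_hermite_Suc_Suc:
  "poly (hermite \<sigma> (Suc (Suc n))) z =
     z * poly (hermite \<sigma> (Suc n)) z - \<sigma> * of_nat (Suc n) * poly (hermite \<sigma> n) z"
  by (subst hermite.simps(2)) (simp only: pderiv_hermite poly_diff poly_mult poly_smult, simp)

lemma degree_hermite: "degree (hermite \<sigma> n) = n \<and> lead_coeff (hermite \<sigma> n) = 1"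
proof (induction n)
  case (Suc n)
  have h: "hermite \<sigma> n \<noteq> 0" using Suc by auto
  have deg: "degree ([:0, 1:] * hermite \<sigma> n) = Suc n"
    using h Suc by (subst degree_mult_eq) auto
  have lc: "coeff ([:0, 1:] * hermite \<sigma> n) (Suc n) = 1"
    using Suc by (simp add: coeff_pCons) metis
  have small: "degree (Polynomial.smult \<sigma> (pderiv (hermite \<sigma> n))) < Suc n"
    using Suc by (auto simp: degree_pderiv)
  have "degree (hermite \<sigma> (Suc n)) = Suc n"
    using degree_add_eq_left[of "- Polynomial.smult \<sigma> (pderiv (hermite \<sigma> n))" "[:0, 1:] * hermite \<sigma> n"] small deg
    by simp
  then show ?case using lc coeff_eq_0[OF small] by simp
qed simp

lemma fps_first_order_ode_unique:
  fixes F G P Q :: "'a::field_char_0 fps"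
  assumes F: "P * fps_deriv F = Q * F" and G: "P * fps_deriv G = Q * G"
    and "fps_nth P 0 \<noteq> 0" and 0: "fps_nth F 0 = fps_nth G 0"
  shows "F = G"
proof (rule fps_ext)
  define R where "R = inverse P * Q"
  have inv: "inverse P * P = 1" using assms(3) by (rule inverse_mult_eq_1)
  have F': "fps_deriv F = R * F" and G': "fps_deriv G = R * G"
    unfolding R_def using arg_cong[OF F, of "\<lambda>x. inverse P * x"] arg_cong[OF G, of "\<lambda>x. inverse P * x"] inv
    by (simp_all flip: mult.assoc)
  fix n show "fps_nth F n = fps_nth G n"
  proof (induction n rule: less_induct)
    case (less n)
    show ?case
    proof (cases n)
      case 0 then show ?thesis using assms(4) by simp
    next
      case (Suc m)
      have "of_nat (Suc m) * fps_nth F (Suc m) = (\<Sum>i=0..m. fps_nth R i * fps_nth F (m - i))"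
        using arg_cong[OF F', of "\<lambda>x. fps_nth x m"] by (simp add: fps_mult_nth)
      also have "\<dots> = (\<Sum>i=0..m. fps_nth R i * fps_nth G (m - i))"
        using less Suc by (intro sum.cong) auto
      also have "\<dots> = of_nat (Suc m) * fps_nth G (Suc m)"
        using arg_cong[OF G', of "\<lambda>x. fps_nth x m"] by (simp add: fps_mult_nth)
      finally show ?thesis using Suc by (simp del: of_nat_Suc)
    qed
  qed
qed

text \<open>Mehler's kernel satisfies a first-order differential equation in the generating variable. Shifting
  the index in one or both factors gives three companion series \<open>G\<close>, \<open>K\<close>, \<open>E\<close>, with \<open>E\<close> the derivative of
  \<open>F\<close>. The three-term recurrence relates them linearly to \<open>F\<close>; eliminating \<open>G\<close> and \<open>K\<close> leaves the equation.\<close>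
lemma hermite_generating_ode:
  fixes z w \<sigma> :: "'a::field_char_0"
  defines "F \<equiv> Abs_fps (\<lambda>n. poly (hermite \<sigma> n) z * poly (hermite \<sigma> n) w / fact n)"
  defines "D \<equiv> 1 - fps_const (\<sigma>\<^sup>2) * fps_X\<^sup>2"
  shows "D\<^sup>2 * fps_deriv F =
    ((fps_const z - fps_const (\<sigma> * w) * fps_X) * (fps_const w - fps_const (\<sigma> * z) * fps_X)
      + fps_const (\<sigma>\<^sup>2) * fps_X * D) * F"
proof -
  define h k where "h n = poly (hermite \<sigma> n) z" and "k n = poly (hermite \<sigma> n) w" for n
  define G K E where "G = Abs_fps (\<lambda>n. h (Suc n) * k n / fact n)"
    and "K = Abs_fps (\<lambda>n. h n * k (Suc n) / fact n)"
    and "E = Abs_fps (\<lambda>n. h (Suc n) * k (Suc n) / fact n)"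
  note [simp del] = hermite.simps of_nat_Suc
  have h1: "h 1 = z * h 0" "k 1 = w * k 0" by (simp_all add: h_def k_def hermite.simps)
  have h2: "h (Suc (Suc n)) = z * h (Suc n) - \<sigma> * of_nat (Suc n) * h n" for n
    by (simp add: h_def poly_hermite_Suc_Suc)
  have k2: "k (Suc (Suc n)) = w * k (Suc n) - \<sigma> * of_nat (Suc n) * k n" for n
    by (simp add: k_def poly_hermite_Suc_Suc)
  have F: "F = Abs_fps (\<lambda>n. h n * k n / fact n)" by (simp add: F_def h_def k_def)
  have dF: "fps_deriv F = E"
    by (rule fps_ext) (simp add: F E_def field_simps)
  have G: "G = fps_const z * F - fps_const \<sigma> * (fps_X * K)"
  proof (rule fps_ext)
    fix n show "fps_nth G n = fps_nth (fps_const z * F - fps_const \<sigma> * (fps_X * K)) n"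
      using h1 by (cases n) (simp_all add: G_def F K_def h2 field_simps)
  qed
  have K: "K = fps_const w * F - fps_const \<sigma> * (fps_X * G)"
  proof (rule fps_ext)
    fix n show "fps_nth K n = fps_nth (fps_const w * F - fps_const \<sigma> * (fps_X * G)) n"
      using h1 by (cases n) (simp_all add: G_def F K_def k2 field_simps)
  qed
  have E: "E = fps_const z * K - fps_const \<sigma> * (fps_X * (fps_const w * K - fps_const \<sigma> * (F + fps_X * E)))"
  proof (rule fps_ext)
    fix n show "fps_nth E n = fps_nth (fps_const z * K - fps_const \<sigma> *
        (fps_X * (fps_const w * K - fps_const \<sigma> * (F + fps_X * E)))) n"
    proof (cases n)
      case 0
      then show ?thesis using h1 by (simp add: E_def K_def)
    next
      case (Suc m)
      have FE: "fps_nth (F + fps_X * E) m = of_nat (Suc m) * h m * k m / fact m"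
      proof (cases m)
        case 0
        then show ?thesis by (simp add: F)
      next
        case (Suc j)
        then have "1 / fact j = of_nat m / (fact m :: 'a)"
          by (simp add: field_simps)
        then have "fps_nth (F + fps_X * E) m = h m * k m / fact m + h m * k m * (of_nat m / fact m)"
          using Suc by (simp add: F E_def flip: mult.assoc)
        then show ?thesis by (simp add: of_nat_Suc field_simps)
      qed
      have "fps_nth (fps_const w * K - fps_const \<sigma> * (F + fps_X * E)) m = h m * k (Suc (Suc m)) / fact m"
        by (simp only: fps_sub_nth fps_mult_left_const_nth FE) (simp add: K_def k2 field_simps)
      then have "fps_nth (fps_const z * K - fps_const \<sigma> * (fps_X * (fps_const w * K - fps_const \<sigma> * (F + fps_X * E)))) n
        = z * (h (Suc m) * k (Suc (Suc m)) / fact (Suc m)) - \<sigma> * (h m * k (Suc (Suc m)) / fact m)"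
        using Suc by (simp add: K_def)
      also have "\<dots> = h (Suc (Suc m)) * k (Suc (Suc m)) / fact (Suc m)"
        by (simp add: h2 field_simps)
      finally show ?thesis using Suc by (simp add: E_def)
    qed
  qed
  let ?z = "fps_const z" and ?w = "fps_const w" and ?s = "fps_const \<sigma>"
  have D: "D = 1 - ?s\<^sup>2 * fps_X\<^sup>2" by (simp add: D_def power2_eq_square)
  have 1: "D * K = (?w - ?s * ?z * fps_X) * F"
    using K unfolding G D by Groebner_Basis.algebra
  have 2: "D * E = (?z - ?s * ?w * fps_X) * K + ?s\<^sup>2 * fps_X * F"
    using E unfolding D by Groebner_Basis.algebra
  have "D\<^sup>2 * E = (?z - ?s * ?w * fps_X) * (D * K) + ?s\<^sup>2 * fps_X * D * F"
    using 2 by Groebner_Basis.algebra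
  also have "\<dots> = ((?z - ?s * ?w * fps_X) * (?w - ?s * ?z * fps_X) + ?s\<^sup>2 * fps_X * D) * F"
    unfolding 1 by Groebner_Basis.algebra
  finally show ?thesis unfolding dF by (simp add: power2_eq_square)
qed

text \<open>The closed form \<open>M\<close> is holomorphic on the disc \<open>\<bar>\<sigma> u\<bar> < 1\<close> and satisfies the differential equation of
  \<open>hermite_generating_ode\<close>, so its Taylor coefficients are those of the generating series. In this way
  convergence of the series on the whole disc needs no estimate of Hermite polynomials.
  The square root is written through \<open>Ln\<close>, which is unproblematic as \<open>1 - \<sigma>\<^sup>2 u\<^sup>2\<close> has positive real part.\<close>
theorem mehler_formula:
  fixes z w \<sigma> u :: complex
  assumes "cmod (\<sigma> * u) < 1"
  shows "(\<lambda>n. poly (hermite \<sigma> n) z * poly (hermite \<sigma> n) w / fact n * u ^ n) sums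
     exp ((z * w * u - \<sigma> * u\<^sup>2 * (z\<^sup>2 + w\<^sup>2) / 2) / (1 - \<sigma>\<^sup>2 * u\<^sup>2) - Ln (1 - \<sigma>\<^sup>2 * u\<^sup>2) / 2)"
proof -
  define M where "M u = exp ((z * w * u - \<sigma> * u\<^sup>2 * (z\<^sup>2 + w\<^sup>2) / 2) / (1 - \<sigma>\<^sup>2 * u\<^sup>2)
     - Ln (1 - \<sigma>\<^sup>2 * u\<^sup>2) / 2)" for u
  define F where "F = Abs_fps (\<lambda>n. poly (hermite \<sigma> n) z * poly (hermite \<sigma> n) w / fact n)"
  \<comment> \<open>A finite radius is required, but for \<open>\<sigma> = 0\<close> the disc is the whole plane.\<close>
  define r where "r = (if \<sigma> = 0 then cmod u + 1 else 1 / cmod \<sigma>)"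
  have r: "cmod u < r" "\<And>v. cmod v < r \<Longrightarrow> cmod (\<sigma> * v) < 1" "0 < r"
    using assms by (auto simp: r_def norm_mult field_simps add_pos_nonneg split: if_splits)
  define dM where "dM v = ((z - \<sigma> * w * v) * (w - \<sigma> * z * v) + \<sigma>\<^sup>2 * v * (1 - \<sigma>\<^sup>2 * v\<^sup>2))
     / (1 - \<sigma>\<^sup>2 * v\<^sup>2)\<^sup>2 * M v" for v
  have re: "Re (1 - \<sigma>\<^sup>2 * v\<^sup>2) > 0" if "cmod v < r" for v
  proof -
    have "cmod ((\<sigma> * v)\<^sup>2) < 1" using r(2)[OF that] by (simp add: norm_power power_less_one_iff)
    then have "Re (\<sigma>\<^sup>2 * v\<^sup>2) < 1" using complex_Re_le_cmod[of "(\<sigma> * v)\<^sup>2"] by (simp add: power_mult_distrib)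
    then show ?thesis by simp
  qed
  have der: "(M has_field_derivative dM v) (at v)" if "cmod v < r" for v
  proof -
    have nz: "1 - \<sigma>\<^sup>2 * v\<^sup>2 \<noteq> 0" "1 - \<sigma>\<^sup>2 * v\<^sup>2 \<notin> \<real>\<^sub>\<le>\<^sub>0"
      using re[OF that] by (force, auto simp: complex_nonpos_Reals_iff)
    have exponent: "((\<lambda>v. (z * w * v - \<sigma> * v\<^sup>2 * (z\<^sup>2 + w\<^sup>2) / 2) / (1 - \<sigma>\<^sup>2 * v\<^sup>2) - Ln (1 - \<sigma>\<^sup>2 * v\<^sup>2) / 2)
       has_field_derivative ((z - \<sigma> * w * v) * (w - \<sigma> * z * v) + \<sigma>\<^sup>2 * v * (1 - \<sigma>\<^sup>2 * v\<^sup>2))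
     / (1 - \<sigma>\<^sup>2 * v\<^sup>2)\<^sup>2) (at v)"
      using nz
      by (auto intro!: derivative_eq_intros)
         (simp add: divide_simps, simp add: power2_eq_square algebra_simps)
    show ?thesis
      using DERIV_chain2[OF DERIV_exp exponent] unfolding M_def dM_def by (simp add: mult.commute)
  qed
  have hol: "M holomorphic_on ball 0 r"
    using der by (subst holomorphic_on_open) (simp, fastforce)
  define D :: "complex fps" where "D = 1 - fps_const (\<sigma>\<^sup>2) * fps_X\<^sup>2"
  define G where "G = fps_expansion M 0"
  have expM: "M has_fps_expansion G"
    unfolding G_def using hol r(3) by (intro has_fps_expansion_fps_expansion[of "ball 0 r"]) auto
  have ev: "eventually (\<lambda>v. v \<in> ball 0 r) (nhds (0::complex))"
    using r(3) by (intro eventually_nhds_in_open) auto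
  have e1: "(\<lambda>v. (1 - \<sigma>\<^sup>2 * v\<^sup>2)\<^sup>2 * deriv M v) has_fps_expansion D\<^sup>2 * fps_deriv G"
    unfolding D_def by (intro fps_expansion_intros expM)
  have e2: "(\<lambda>v. ((z - (\<sigma> * w) * v) * (w - (\<sigma> * z) * v) + \<sigma>\<^sup>2 * v * (1 - \<sigma>\<^sup>2 * v\<^sup>2)) * M v) has_fps_expansion
     ((fps_const z - fps_const (\<sigma> * w) * fps_X) * (fps_const w - fps_const (\<sigma> * z) * fps_X)
      + fps_const (\<sigma>\<^sup>2) * fps_X * D) * G"
    unfolding D_def by (intro fps_expansion_intros expM)
  have e3: "eventually (\<lambda>v. (1 - \<sigma>\<^sup>2 * v\<^sup>2)\<^sup>2 * deriv M v =
     ((z - (\<sigma> * w) * v) * (w - (\<sigma> * z) * v) + \<sigma>\<^sup>2 * v * (1 - \<sigma>\<^sup>2 * v\<^sup>2)) * M v) (nhds 0)"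
    using ev
  proof eventually_elim
    case (elim v)
    then have "Re (1 - \<sigma>\<^sup>2 * v\<^sup>2) > 0" using re by simp
    then have "1 - \<sigma>\<^sup>2 * v\<^sup>2 \<noteq> 0" by (metis order_less_irrefl zero_complex.sel(1))
    moreover have "deriv M v = dM v"
      by (rule DERIV_imp_deriv[OF der]) (use elim in simp)
    moreover have "p\<^sup>2 * (x / p\<^sup>2 * m) = x * m" if "p \<noteq> 0" for p x m :: complex
      using that by simp
    ultimately show ?case unfolding dM_def by metis
  qed
  have ode: "D\<^sup>2 * fps_deriv G =
     ((fps_const z - fps_const (\<sigma> * w) * fps_X) * (fps_const w - fps_const (\<sigma> * z) * fps_X)
      + fps_const (\<sigma>\<^sup>2) * fps_X * D) * G"
    using e2 unfolding has_fps_expansion_cong[OF e3 refl, symmetric] by (rule fps_expansion_unique_complex[OF e1])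
  have "F = G"
  proof (rule fps_first_order_ode_unique[OF hermite_generating_ode[of \<sigma> z w, folded F_def D_def] ode])
    show "fps_nth (D\<^sup>2) 0 \<noteq> 0" by (simp add: D_def power2_eq_square)
    show "fps_nth F 0 = fps_nth G 0"
      using has_fps_expansion_imp_0_eq_fps_nth_0[OF expM] by (simp add: F_def M_def)
  qed
  have hol': "M holomorphic_on eball 0 (ereal r)"
    using hol by simp
  have "(\<lambda>n. fps_nth G n * u ^ n) sums M u"
    by (rule has_fps_expansion_imp_sums_complex[OF expM hol']) (use r(1) in simp)
  then show ?thesis unfolding \<open>F = G\<close>[symmetric] unfolding F_def M_def fps_nth_Abs_fps .
qed

lemma poly_hermite_cnj:
  "poly (hermite (complex_of_real \<sigma>) n) (cnj z) = cnj (poly (hermite (complex_of_real \<sigma>) n) z)"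
proof (induction n rule: less_induct)
  case (less n)
  consider "n = 0" | "n = 1" | m where "n = Suc (Suc m)"
    by (metis One_nat_def old.nat.exhaust)
  then show ?case
  proof cases
    case 3
    then show ?thesis using less[of m] less[of "Suc m"] by (simp add: poly_hermite_Suc_Suc del: hermite.simps of_nat_Suc)
  qed simp_all
qed

text \<open>For \<open>w\<close> the conjugate of \<open>z\<close> the exponent separates into the contributions of the real and the imaginary part.\<close>
lemma mehler_formula_diagonal:
  fixes \<sigma> u :: real and z :: complex
  assumes u: "\<bar>\<sigma> * u\<bar> < 1"
  shows "(\<lambda>n. (cmod (poly (hermite (complex_of_real \<sigma>) n) z))\<^sup>2 / fact n * u ^ n) sums
     (exp (u * (Re z)\<^sup>2 / (1 + \<sigma> * u) + u * (Im z)\<^sup>2 / (1 - \<sigma> * u)) / sqrt (1 - (\<sigma> * u)\<^sup>2))"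
proof -
  let ?H = "hermite (complex_of_real \<sigma>)"
  define X Y t where "X = Re z" and "Y = Im z" and "t = \<sigma> * u"
  have t: "- 1 < t" "t < 1" using u by (auto simp: t_def)
  have q: "1 - t\<^sup>2 > 0" using u by (simp add: t_def abs_square_less_1)
  have ut: "\<sigma>\<^sup>2 * u\<^sup>2 = t\<^sup>2" "\<sigma> * u\<^sup>2 = t * u" by (simp_all add: t_def power2_eq_square)
  have z: "z = of_real X + \<i> * of_real Y" "cnj z = of_real X - \<i> * of_real Y"
    by (simp_all add: X_def Y_def complex_eq_iff)
  have zz: "z * cnj z = of_real (X\<^sup>2 + Y\<^sup>2)" "z\<^sup>2 + (cnj z)\<^sup>2 = of_real (2 * (X\<^sup>2 - Y\<^sup>2))"
    unfolding z by (simp_all add: algebra_simps power2_eq_square)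
  have expo: "((X\<^sup>2 + Y\<^sup>2) * u - t * u * (2 * (X\<^sup>2 - Y\<^sup>2)) / 2) / (1 - t\<^sup>2) = u * X\<^sup>2 / (1 + t) + u * Y\<^sup>2 / (1 - t)"
    using t q by (simp add: divide_simps) (simp add: power2_eq_square algebra_simps)
  have "(\<lambda>n. poly (?H n) z * poly (?H n) (cnj z) / fact n * complex_of_real u ^ n) sums
     exp ((z * cnj z * of_real u - of_real \<sigma> * (of_real u)\<^sup>2 * (z\<^sup>2 + (cnj z)\<^sup>2) / 2) / (1 - (of_real \<sigma>)\<^sup>2 * (of_real u)\<^sup>2)
        - Ln (1 - (of_real \<sigma>)\<^sup>2 * (of_real u)\<^sup>2) / 2)"
    by (rule mehler_formula) (use u in \<open>simp flip: of_real_mult\<close>)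
  also have "(\<lambda>n. poly (?H n) z * poly (?H n) (cnj z) / fact n * complex_of_real u ^ n) =
     (\<lambda>n. complex_of_real ((cmod (poly (?H n) z))\<^sup>2 / fact n * u ^ n))"
    by (simp add: poly_hermite_cnj complex_norm_square del: of_real_power) (simp add: complex_norm_square)
  also have "exp ((z * cnj z * of_real u - of_real \<sigma> * (of_real u)\<^sup>2 * (z\<^sup>2 + (cnj z)\<^sup>2) / 2) / (1 - (of_real \<sigma>)\<^sup>2 * (of_real u)\<^sup>2)
        - Ln (1 - (of_real \<sigma>)\<^sup>2 * (of_real u)\<^sup>2) / 2)
     = complex_of_real (exp (((X\<^sup>2 + Y\<^sup>2) * u - t * u * (2 * (X\<^sup>2 - Y\<^sup>2)) / 2) / (1 - t\<^sup>2) - ln (1 - t\<^sup>2) / 2))"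
  proof -
    have c: "1 - (complex_of_real \<sigma>)\<^sup>2 * (of_real u)\<^sup>2 = of_real (1 - t\<^sup>2)" "complex_of_real \<sigma> * (of_real u)\<^sup>2 = of_real (t * u)"
      by (simp_all flip: ut)
    show ?thesis
      unfolding c zz Ln_of_real[OF q] exp_of_real[symmetric] by simp
  qed
  finally have "(\<lambda>n. (cmod (poly (?H n) z))\<^sup>2 / fact n * u ^ n) sums
     exp (u * X\<^sup>2 / (1 + t) + u * Y\<^sup>2 / (1 - t) - ln (1 - t\<^sup>2) / 2)"
    unfolding sums_of_real_iff expo .
  also have "exp (u * X\<^sup>2 / (1 + t) + u * Y\<^sup>2 / (1 - t) - ln (1 - t\<^sup>2) / 2) =
     exp (u * X\<^sup>2 / (1 + t) + u * Y\<^sup>2 / (1 - t)) / sqrt (1 - t\<^sup>2)"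
    using q by (simp add: exp_diff ln_sqrt[symmetric])
  finally show ?thesis by (simp add: X_def Y_def t_def)
qed

section \<open>Orthogonality of Hermite polynomials for a planar Gaussian weight\<close>

lemma measurable_Complex_pair: "(\<lambda>(x, y). Complex x y) \<in> borel_measurable (lborel \<Otimes>\<^sub>M lborel)"
proof -
  have "(\<lambda>(x, y). Complex x y) \<in> borel_measurable borel"
    by (auto simp: case_prod_beta Complex_eq intro!: borel_measurable_continuous_onI continuous_intros)
  then show ?thesis by (simp add: lborel_prod)
qed

lemma lborel_complex_eq_distr:
  "distr (lborel \<Otimes>\<^sub>M lborel) borel (\<lambda>(x, y). Complex x y) = lborel"
proof (rule lborel_eqI[symmetric])
  note measurable_Complex_pair[measurable]
  fix l u :: complex assume le: "\<And>b. b \<in> Basis \<Longrightarrow> l \<bullet> b \<le> u \<bullet> b"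
  have *: "Re l \<le> Re u" "Im l \<le> Im u" using le[of 1] le[of \<i>] by (auto simp: Basis_complex_def)
  have "(\<lambda>(x, y). Complex x y) -` box l u \<inter> space (lborel \<Otimes>\<^sub>M lborel) = box (Re l) (Re u) \<times> box (Im l) (Im u)"
    by (auto simp: box_def Basis_complex_def space_pair_measure)
  then have "emeasure (distr (lborel \<Otimes>\<^sub>M lborel) borel (\<lambda>(x, y). Complex x y)) (box l u)
      = emeasure (lborel \<Otimes>\<^sub>M lborel) (box (Re l) (Re u) \<times> box (Im l) (Im u))"
    by (subst emeasure_distr) auto
  also have "\<dots> = ennreal (Re u - Re l) * ennreal (Im u - Im l)"
    using * by (subst lborel.emeasure_pair_measure_Times) auto
  also have "\<dots> = ennreal (\<Prod>b\<in>Basis. (u - l) \<bullet> b)"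
    using * by (simp add: Basis_complex_def ennreal_mult)
  finally show "emeasure (distr (lborel \<Otimes>\<^sub>M lborel) borel (\<lambda>(x, y). Complex x y)) (box l u)
     = ennreal (\<Prod>b\<in>Basis. (u - l) \<bullet> b)" .
qed simp

lemma integrable_complex_iff_pair:
  fixes f :: "complex \<Rightarrow> 'b::{banach, second_countable_topology}"
  assumes "f \<in> borel_measurable borel"
  shows "integrable lborel f \<longleftrightarrow> integrable (lborel \<Otimes>\<^sub>M lborel) (\<lambda>(x, y). f (Complex x y))"
  by (subst lborel_complex_eq_distr[symmetric], subst integrable_distr_eq[OF measurable_Complex_pair])
     (use assms in \<open>auto simp: case_prod_unfold\<close>)

lemma integral_complex_iterated:
  fixes f :: "complex \<Rightarrow> 'b::{banach, second_countable_topology}"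
  assumes f: "integrable lborel f"
  shows "(\<integral>z. f z \<partial>lborel) = (\<integral>y. (\<integral>x. f (Complex x y) \<partial>lborel) \<partial>lborel)"
    and "(\<integral>z. f z \<partial>lborel) = (\<integral>x. (\<integral>y. f (Complex x y) \<partial>lborel) \<partial>lborel)"
proof -
  have meas: "f \<in> borel_measurable borel" using f by auto
  have int: "integrable (lborel \<Otimes>\<^sub>M lborel) (\<lambda>(x, y). f (Complex x y))"
    using f integrable_complex_iff_pair[OF meas] by simp
  have "(\<integral>z. f z \<partial>lborel) = (\<integral>z. f z \<partial>distr (lborel \<Otimes>\<^sub>M lborel) borel (\<lambda>(x, y). Complex x y))"
    by (simp add: lborel_complex_eq_distr)
  also have "\<dots> = (\<integral>(x, y). f (Complex x y) \<partial>(lborel \<Otimes>\<^sub>M lborel))"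
    using meas by (subst integral_distr[OF measurable_Complex_pair]) (auto simp: case_prod_unfold)
  finally have eq: "(\<integral>z. f z \<partial>lborel) = (\<integral>(x, y). f (Complex x y) \<partial>(lborel \<Otimes>\<^sub>M lborel))" .
  show "(\<integral>z. f z \<partial>lborel) = (\<integral>y. (\<integral>x. f (Complex x y) \<partial>lborel) \<partial>lborel)"
    unfolding eq by (rule lborel_pair.integral_snd[OF int, symmetric])
  show "(\<integral>z. f z \<partial>lborel) = (\<integral>x. (\<integral>y. f (Complex x y) \<partial>lborel) \<partial>lborel)"
    unfolding eq by (rule lborel_pair.integral_fst'[OF int, symmetric, unfolded case_prod_conv])
qed

lemma normal_moment_recursion:
  assumes "\<sigma> > 0"
  defines "m \<equiv> \<lambda>k. \<integral>x. normal_density 0 \<sigma> x * x ^ k \<partial>lborel"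
  shows "m (Suc 0) = 0" "m (Suc (Suc k)) = \<sigma>\<^sup>2 * real (Suc k) * m k"
proof -
  have ev: "m (2 * j) = fact (2 * j) / ((2 / \<sigma>\<^sup>2) ^ j * fact j)" for j
    using has_bochner_integral_integral_eq[OF normal_moment_even[OF assms(1), of 0 j]] by (simp add: m_def)
  have od: "m (Suc (2 * j)) = 0" for j
    using has_bochner_integral_integral_eq[OF normal_moment_odd[OF assms(1), of 0 j]] by (simp add: m_def)
  show "m (Suc 0) = 0" using od[of 0] by simp
  show "m (Suc (Suc k)) = \<sigma>\<^sup>2 * real (Suc k) * m k"
  proof (cases "even k")
    case True
    then obtain j where k: "k = 2 * j" by (elim evenE)
    have "m (Suc (Suc k)) = fact (2 * Suc j) / ((2 / \<sigma>\<^sup>2) ^ Suc j * fact (Suc j))"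
      using ev[of "Suc j"] k by simp
    also have "\<dots> = \<sigma>\<^sup>2 * real (Suc k) * (fact (2 * j) / ((2 / \<sigma>\<^sup>2) ^ j * fact j))"
      using assms(1) k by (simp add: divide_simps)
    finally show ?thesis using ev[of j] k by simp
  next
    case False
    then obtain j where "k = 2 * j + 1" by (elim oddE)
    then show ?thesis using od[of j] od[of "Suc j"] by simp
  qed
qed

lemma has_bochner_integral_normal_poly:
  fixes P :: "complex poly"
  assumes "\<sigma> > 0" and "degree P \<le> n"
  shows "has_bochner_integral lborel (\<lambda>x. of_real (normal_density 0 \<sigma> x) * poly P (of_real x))
     (\<Sum>i\<le>n. coeff P i * of_real (\<integral>x. normal_density 0 \<sigma> x * x ^ i \<partial>lborel))"
proof -
  have "of_real (normal_density 0 \<sigma> x) * poly P (of_real x) =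
     (\<Sum>i\<le>n. coeff P i * of_real (normal_density 0 \<sigma> x * x ^ i))" for x
  proof -
    have "poly P (of_real x) = (\<Sum>i\<le>n. coeff P i * of_real x ^ i)"
      unfolding poly_altdef using assms(2) by (intro sum.mono_neutral_left) (auto simp: coeff_eq_0)
    then show ?thesis by (simp add: sum_distrib_left mult_ac)
  qed
  moreover have "has_bochner_integral lborel (\<lambda>x. complex_of_real (normal_density 0 \<sigma> x * x ^ i))
     (of_real (\<integral>x. normal_density 0 \<sigma> x * x ^ i \<partial>lborel))" for i
    using integrable_normal_moment[OF assms(1), of 0 i]
    by (intro has_bochner_integral_of_real has_bochner_integral_integrable) simp
  ultimately show ?thesis
    by (auto intro!: has_bochner_integral_sum has_bochner_integral_mult_right)
qed

text \<open>Gaussian integration by parts, read off from the recursion of the normal moments.\<close>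
lemma stein_identity_poly:
  fixes P :: "complex poly"
  assumes "\<sigma> > 0"
  shows "(\<integral>x. of_real (normal_density 0 \<sigma> x) * (of_real x * poly P (of_real x)) \<partial>lborel) =
     of_real (\<sigma>\<^sup>2) * (\<integral>x. of_real (normal_density 0 \<sigma> x) * poly (pderiv P) (of_real x) \<partial>lborel)"
proof -
  define m where "m k = (\<integral>x. normal_density 0 \<sigma> x * x ^ k \<partial>lborel)" for k
  define n where "n = degree P"
  have "(\<integral>x. of_real (normal_density 0 \<sigma> x) * (of_real x * poly P (of_real x)) \<partial>lborel) =
     (\<integral>x. of_real (normal_density 0 \<sigma> x) * poly (pCons 0 P) (of_real x) \<partial>lborel)" by simp
  also have "\<dots> = (\<Sum>i\<le>Suc n. coeff (pCons 0 P) i * of_real (m i))"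
    unfolding m_def
    by (rule has_bochner_integral_integral_eq[OF has_bochner_integral_normal_poly[OF assms]])
       (auto simp: n_def degree_pCons_le)
  also have "\<dots> = (\<Sum>i\<le>n. coeff P i * of_real (m (Suc i)))"
    by (subst sum.atMost_Suc_shift) simp
  also have "\<dots> = (\<Sum>i\<le>Suc n. coeff P i * of_real (m (Suc i)))"
    by (simp add: n_def coeff_eq_0)
  also have "\<dots> = (\<Sum>i\<le>n. coeff P (Suc i) * of_real (m (Suc (Suc i))))"
    using normal_moment_recursion(1)[OF assms] by (subst sum.atMost_Suc_shift) (simp add: m_def)
  also have "\<dots> = of_real (\<sigma>\<^sup>2) * (\<Sum>i\<le>n. coeff (pderiv P) i * of_real (m i))"
    using normal_moment_recursion(2)[OF assms]
    by (simp add: m_def coeff_pderiv sum_distrib_left mult_ac del: of_nat_Suc)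
  also have "(\<Sum>i\<le>n. coeff (pderiv P) i * of_real (m i)) =
     (\<integral>x. of_real (normal_density 0 \<sigma> x) * poly (pderiv P) (of_real x) \<partial>lborel)"
    unfolding m_def
    by (rule has_bochner_integral_integral_eq[OF has_bochner_integral_normal_poly[OF assms], symmetric])
       (auto simp: n_def degree_pderiv)
  finally show ?thesis .
qed

definition gauss2 :: "real \<Rightarrow> real \<Rightarrow> complex \<Rightarrow> real" where
  "gauss2 s1 s2 z = normal_density 0 s1 (Re z) * normal_density 0 s2 (Im z)"

lemma borel_measurable_gauss2[measurable]: "gauss2 s1 s2 \<in> borel_measurable borel"
  unfolding gauss2_def by measurable

lemma integrable_prod_lborel:
  fixes u v :: "real \<Rightarrow> real"
  assumes u: "integrable lborel u" and v: "integrable lborel v"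
  shows "integrable (lborel \<Otimes>\<^sub>M lborel) (\<lambda>(x, y). u x * v y)"
proof (rule lborel_pair.Fubini_integrable)
  have [measurable]: "u \<in> borel_measurable borel" "v \<in> borel_measurable borel" using u v by auto
  show "(\<lambda>(x, y). u x * v y) \<in> borel_measurable (lborel \<Otimes>\<^sub>M lborel)" by measurable
  show "integrable lborel (\<lambda>x. \<integral>y. norm (case (x, y) of (x, y) \<Rightarrow> u x * v y) \<partial>lborel)"
    using u by (simp add: abs_mult)
  show "AE x in lborel. integrable lborel (\<lambda>y. case (x, y) of (x, y) \<Rightarrow> u x * v y)"
    using v by simp
qed

lemma has_bochner_integral_gauss2:
  assumes "s1 > 0" "s2 > 0"
  shows "has_bochner_integral lborel (gauss2 s1 s2) 1"
proof -
  have int: "integrable lborel (gauss2 s1 s2)"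
    using integrable_prod_lborel[OF integrable_normal_density[OF assms(1), of 0] integrable_normal_density[OF assms(2), of 0]]
    by (subst integrable_complex_iff_pair) (auto simp: gauss2_def)
  moreover have "(\<integral>z. gauss2 s1 s2 z \<partial>lborel) = 1"
    unfolding integral_complex_iterated(1)[OF int] by (simp add: gauss2_def assms)
  ultimately show ?thesis by (simp add: has_bochner_integral_iff)
qed

text \<open>Integrability against the Gaussian together with all monomials in the two coordinates. Unlike mere
  integrability this is inherited by products with \<open>Re z\<close> and \<open>Im z\<close>, so it passes by induction
  to products with polynomials in \<open>z\<close> and its conjugate.\<close>
definition gauss2_tempered :: "real \<Rightarrow> real \<Rightarrow> (complex \<Rightarrow> complex) \<Rightarrow> bool" where
  "gauss2_tempered s1 s2 F \<longleftrightarrow>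
     (\<forall>i j. integrable lborel (\<lambda>z. of_real (gauss2 s1 s2 z * Re z ^ i * Im z ^ j) * F z))"

lemma gauss2_temperedD: "gauss2_tempered s1 s2 F \<Longrightarrow> integrable lborel (\<lambda>z. of_real (gauss2 s1 s2 z) * F z)"
  unfolding gauss2_tempered_def by (drule spec[of _ 0], drule spec[of _ 0]) simp

lemma gauss2_tempered_1:
  assumes "s1 > 0" "s2 > 0"
  shows "gauss2_tempered s1 s2 (\<lambda>_. 1)"
proof -
  have "integrable lborel (\<lambda>z. gauss2 s1 s2 z * Re z ^ i * Im z ^ j)" for i j
    using integrable_prod_lborel[OF integrable_normal_moment[OF assms(1), of 0 i] integrable_normal_moment[OF assms(2), of 0 j]]
    by (subst integrable_complex_iff_pair) (auto simp: gauss2_def mult_ac)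
  then have "integrable lborel (\<lambda>z. complex_of_real (gauss2 s1 s2 z * Re z ^ i * Im z ^ j))" for i j
    by (rule integrable_of_real)
  then show ?thesis unfolding gauss2_tempered_def by (simp del: of_real_mult of_real_power)
qed

lemma gauss2_tempered_Re: "gauss2_tempered s1 s2 F \<Longrightarrow> gauss2_tempered s1 s2 (\<lambda>z. of_real (Re z) * F z)"
  unfolding gauss2_tempered_def
proof (intro allI)
  fix i j
  assume "\<forall>i j. integrable lborel (\<lambda>z. of_real (gauss2 s1 s2 z * Re z ^ i * Im z ^ j) * F z)"
  from this[rule_format, of "Suc i" j]
  show "integrable lborel (\<lambda>z. of_real (gauss2 s1 s2 z * Re z ^ i * Im z ^ j) * (of_real (Re z) * F z))"
    by (simp add: mult_ac)
qed

lemma gauss2_tempered_Im: "gauss2_tempered s1 s2 F \<Longrightarrow> gauss2_tempered s1 s2 (\<lambda>z. of_real (Im z) * F z)"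
  unfolding gauss2_tempered_def
proof (intro allI)
  fix i j
  assume "\<forall>i j. integrable lborel (\<lambda>z. of_real (gauss2 s1 s2 z * Re z ^ i * Im z ^ j) * F z)"
  from this[rule_format, of i "Suc j"]
  show "integrable lborel (\<lambda>z. of_real (gauss2 s1 s2 z * Re z ^ i * Im z ^ j) * (of_real (Im z) * F z))"
    by (simp add: mult_ac)
qed

lemma gauss2_tempered_lincomb:
  assumes "gauss2_tempered s1 s2 F" "gauss2_tempered s1 s2 G"
  shows "gauss2_tempered s1 s2 (\<lambda>z. a * F z + b * G z)"
  unfolding gauss2_tempered_def
proof (intro allI)
  fix i j
  have "integrable lborel (\<lambda>z. a * (of_real (gauss2 s1 s2 z * Re z ^ i * Im z ^ j) * F z)
      + b * (of_real (gauss2 s1 s2 z * Re z ^ i * Im z ^ j) * G z))"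
    using assms unfolding gauss2_tempered_def by (intro Bochner_Integration.integrable_add integrable_mult_right) auto
  then show "integrable lborel (\<lambda>z. of_real (gauss2 s1 s2 z * Re z ^ i * Im z ^ j) * (a * F z + b * G z))"
    by (simp add: algebra_simps)
qed

lemma gauss2_tempered_poly:
  assumes "gauss2_tempered s1 s2 F"
  shows "gauss2_tempered s1 s2 (\<lambda>z. poly p z * F z)" and "gauss2_tempered s1 s2 (\<lambda>z. cnj (poly p z) * F z)"
proof (induction p)
  case 0
  { case 1 show ?case using gauss2_tempered_lincomb[OF assms assms, of 0 0] by simp }
  { case 2 show ?case using gauss2_tempered_lincomb[OF assms assms, of 0 0] by simp }
next
  case (pCons a p)
  { case 1
    have "gauss2_tempered s1 s2 (\<lambda>z. 1 * (of_real (Re z) * (poly p z * F z)) + \<i> * (of_real (Im z) * (poly p z * F z)))"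
      by (intro gauss2_tempered_lincomb gauss2_tempered_Re gauss2_tempered_Im pCons)
    moreover have "1 * (of_real (Re z) * (poly p z * F z)) + \<i> * (of_real (Im z) * (poly p z * F z)) = z * poly p z * F z" for z
      by (subst (5) complex_eq) (simp add: algebra_simps)
    ultimately have "gauss2_tempered s1 s2 (\<lambda>z. a * F z + 1 * (z * poly p z * F z))"
      by (intro gauss2_tempered_lincomb assms) simp
    then show ?case by (simp add: algebra_simps) }
  { case 2
    have "gauss2_tempered s1 s2 (\<lambda>z. 1 * (of_real (Re z) * (cnj (poly p z) * F z)) + (- \<i>) * (of_real (Im z) * (cnj (poly p z) * F z)))"
      by (intro gauss2_tempered_lincomb gauss2_tempered_Re gauss2_tempered_Im pCons)
    moreover have "1 * (of_real (Re z) * (cnj (poly p z) * F z)) + (- \<i>) * (of_real (Im z) * (cnj (poly p z) * F z)) = cnj z * cnj (poly p z) * F z" for z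
    proof -
      have "cnj z = of_real (Re z) - \<i> * of_real (Im z)" by (simp add: complex_eq_iff)
      then show ?thesis unfolding \<open>cnj z = _\<close> by (simp add: algebra_simps)
    qed
    ultimately have "gauss2_tempered s1 s2 (\<lambda>z. cnj a * F z + 1 * (cnj z * cnj (poly p z) * F z))"
      by (intro gauss2_tempered_lincomb assms) simp
    then show ?case by (simp add: algebra_simps) }
qed

definition gauss_inner :: "real \<Rightarrow> real \<Rightarrow> complex poly \<Rightarrow> complex poly \<Rightarrow> complex" where
  "gauss_inner s1 s2 f g = (\<integral>z. of_real (gauss2 s1 s2 z) * (poly f z * cnj (poly g z)) \<partial>lborel)"

context
  fixes s1 s2 :: real
  assumes pos: "s1 > 0" "s2 > 0"
begin

lemma tempered_inner: "gauss2_tempered s1 s2 (\<lambda>z. poly f z * cnj (poly g z))"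
  using gauss2_tempered_poly(1)[OF gauss2_tempered_poly(2)[OF gauss2_tempered_1[OF pos], of g], of f] by simp

lemma integrable_inner: "integrable lborel (\<lambda>z. of_real (gauss2 s1 s2 z) * (poly f z * cnj (poly g z)))"
  by (rule gauss2_temperedD[OF tempered_inner])

text \<open>For fixed imaginary part, \<open>f\<close> times the conjugate of \<open>g\<close> is a polynomial in the real part, to which the
  one-dimensional identity applies; its derivative consists of one term for each factor. In the
  imaginary direction the two terms carry the opposite factors \<open>\<i>\<close> and \<open>- \<i>\<close>.\<close>
lemma stein_Re:
  "(\<integral>z. of_real (gauss2 s1 s2 z) * (of_real (Re z) * (poly f z * cnj (poly g z))) \<partial>lborel) =
     of_real (s1\<^sup>2) * (gauss_inner s1 s2 (pderiv f) g + gauss_inner s1 s2 f (pderiv g))"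
proof -
  let ?n1 = "\<lambda>x. complex_of_real (normal_density 0 s1 x)" and ?n2 = "\<lambda>x. complex_of_real (normal_density 0 s2 x)"
  define G where "G = map_poly cnj g"
  have sub: "poly [:\<i> * of_real y, 1:] (of_real x) = Complex x y"
    "poly [:- \<i> * of_real y, 1:] (of_real x) = cnj (Complex x y)" for x y
    by (simp_all add: complex_eq_iff)
  define P where "P y = pcompose f [:\<i> * of_real y, 1:] * pcompose G [:- \<i> * of_real y, 1:]" for y :: real
  have P: "poly (P y) (of_real x) = poly f (Complex x y) * cnj (poly g (Complex x y))" for x y
    by (simp only: P_def G_def poly_mult poly_pcompose sub poly_cnj)
  have G': "pderiv G = map_poly cnj (pderiv g)"
    by (rule poly_eqI) (simp add: G_def coeff_pderiv coeff_map_poly)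
  have P': "poly (pderiv (P y)) (of_real x) = poly (pderiv f) (Complex x y) * cnj (poly g (Complex x y))
       + poly f (Complex x y) * cnj (poly (pderiv g) (Complex x y))" for x y
    unfolding P_def pderiv_mult pderiv_pcompose G'
    by (simp only: G_def poly_mult poly_add poly_pcompose sub poly_cnj) (simp add: pderiv_pCons algebra_simps)
  have "(\<integral>z. of_real (gauss2 s1 s2 z) * (of_real (Re z) * (poly f z * cnj (poly g z))) \<partial>lborel) =
    (\<integral>y. (\<integral>x. ?n2 y * (?n1 x * (of_real x * poly (P y) (of_real x))) \<partial>lborel) \<partial>lborel)"
    by (subst integral_complex_iterated(1)[OF gauss2_temperedD[OF gauss2_tempered_Re[OF tempered_inner]]])
       (simp add: P gauss2_def mult_ac)
  also have "\<dots> = (\<integral>y. (\<integral>x. of_real (s1\<^sup>2) * (?n2 y * (?n1 x * poly (pderiv (P y)) (of_real x))) \<partial>lborel) \<partial>lborel)"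
    by (rule Bochner_Integration.integral_cong[OF refl])
       (unfold integral_mult_right_zero stein_identity_poly[OF pos(1)], rule mult.left_commute)
  also have "\<dots> = (\<integral>z. of_real (s1\<^sup>2) * (of_real (gauss2 s1 s2 z) * (poly (pderiv f) z * cnj (poly g z))
       + of_real (gauss2 s1 s2 z) * (poly f z * cnj (poly (pderiv g) z))) \<partial>lborel)"
    by (subst integral_complex_iterated(1)[OF integrable_mult_right[OF Bochner_Integration.integrable_add[OF integrable_inner integrable_inner]]])
       (simp add: P' gauss2_def algebra_simps)
  also have "\<dots> = of_real (s1\<^sup>2) * (gauss_inner s1 s2 (pderiv f) g + gauss_inner s1 s2 f (pderiv g))"
    by (simp add: gauss_inner_def Bochner_Integration.integral_add[OF integrable_inner integrable_inner])
  finally show ?thesis .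
qed

lemma stein_Im:
  "(\<integral>z. of_real (gauss2 s1 s2 z) * (of_real (Im z) * (poly f z * cnj (poly g z))) \<partial>lborel) =
     of_real (s2\<^sup>2) * \<i> * (gauss_inner s1 s2 (pderiv f) g - gauss_inner s1 s2 f (pderiv g))"
proof -
  let ?n1 = "\<lambda>x. complex_of_real (normal_density 0 s1 x)" and ?n2 = "\<lambda>x. complex_of_real (normal_density 0 s2 x)"
  define G where "G = map_poly cnj g"
  have sub: "poly [:of_real x, \<i>:] (of_real y) = Complex x y"
    "poly [:of_real x, - \<i>:] (of_real y) = cnj (Complex x y)" for x y
    by (simp_all add: complex_eq_iff)
  define P where "P x = pcompose f [:of_real x, \<i>:] * pcompose G [:of_real x, - \<i>:]" for x :: real
  have P: "poly (P x) (of_real y) = poly f (Complex x y) * cnj (poly g (Complex x y))" for x y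
    by (simp only: P_def G_def poly_mult poly_pcompose sub poly_cnj)
  have G': "pderiv G = map_poly cnj (pderiv g)"
    by (rule poly_eqI) (simp add: G_def coeff_pderiv coeff_map_poly)
  have P': "poly (pderiv (P x)) (of_real y) = \<i> * (poly (pderiv f) (Complex x y) * cnj (poly g (Complex x y))
       - poly f (Complex x y) * cnj (poly (pderiv g) (Complex x y)))" for x y
    unfolding P_def pderiv_mult pderiv_pcompose G'
    by (simp only: G_def poly_mult poly_add poly_pcompose sub poly_cnj) (simp add: pderiv_pCons algebra_simps)
  have "(\<integral>z. of_real (gauss2 s1 s2 z) * (of_real (Im z) * (poly f z * cnj (poly g z))) \<partial>lborel) =
    (\<integral>x. (\<integral>y. ?n1 x * (?n2 y * (of_real y * poly (P x) (of_real y))) \<partial>lborel) \<partial>lborel)"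
    by (subst integral_complex_iterated(2)[OF gauss2_temperedD[OF gauss2_tempered_Im[OF tempered_inner]]])
       (simp add: P gauss2_def mult_ac)
  also have "\<dots> = (\<integral>x. (\<integral>y. of_real (s2\<^sup>2) * (?n1 x * (?n2 y * poly (pderiv (P x)) (of_real y))) \<partial>lborel) \<partial>lborel)"
    by (rule Bochner_Integration.integral_cong[OF refl])
       (unfold integral_mult_right_zero stein_identity_poly[OF pos(2)], rule mult.left_commute)
  also have "\<dots> = (\<integral>z. of_real (s2\<^sup>2) * \<i> * (of_real (gauss2 s1 s2 z) * (poly (pderiv f) z * cnj (poly g z))
       - of_real (gauss2 s1 s2 z) * (poly f z * cnj (poly (pderiv g) z))) \<partial>lborel)"
    by (subst integral_complex_iterated(2)[OF integrable_mult_right[OF Bochner_Integration.integrable_diff[OF integrable_inner integrable_inner]]])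
       (simp add: P' gauss2_def algebra_simps)
  also have "\<dots> = of_real (s2\<^sup>2) * \<i> * (gauss_inner s1 s2 (pderiv f) g - gauss_inner s1 s2 f (pderiv g))"
    by (simp add: gauss_inner_def Bochner_Integration.integral_diff[OF integrable_inner integrable_inner])
  finally show ?thesis .
qed

text \<open>Add the identity for the real part and \<open>\<i>\<close> times the one for the imaginary part. The derivative of \<open>f\<close>
  appears with factor \<open>s1\<^sup>2 - s2\<^sup>2\<close> and that of \<open>g\<close> with factor \<open>s1\<^sup>2 + s2\<^sup>2\<close>, so the raising operator with
  parameter \<open>s1\<^sup>2 - s2\<^sup>2\<close> is adjoint to a multiple of differentiation.\<close>
lemma gauss_inner_raise:
  "gauss_inner s1 s2 ([:0, 1:] * f - Polynomial.smult (of_real (s1\<^sup>2 - s2\<^sup>2)) (pderiv f)) g =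
     of_real (s1\<^sup>2 + s2\<^sup>2) * gauss_inner s1 s2 f (pderiv g)"
proof -
  let ?w = "\<lambda>z. complex_of_real (gauss2 s1 s2 z)"
  note ints = gauss2_temperedD[OF gauss2_tempered_Re[OF tempered_inner[of f g]]]
    gauss2_temperedD[OF gauss2_tempered_Im[OF tempered_inner[of f g]]] integrable_inner[of "pderiv f" g]
  have "gauss_inner s1 s2 ([:0, 1:] * f - Polynomial.smult (of_real (s1\<^sup>2 - s2\<^sup>2)) (pderiv f)) g =
    (\<integral>z. ?w z * (of_real (Re z) * (poly f z * cnj (poly g z))) + \<i> * (?w z * (of_real (Im z) * (poly f z * cnj (poly g z))))
       - of_real (s1\<^sup>2 - s2\<^sup>2) * (?w z * (poly (pderiv f) z * cnj (poly g z))) \<partial>lborel)"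
    unfolding gauss_inner_def
  proof (intro Bochner_Integration.integral_cong refl)
    fix z
    have "z * (poly f z * cnj (poly g z)) = of_real (Re z) * (poly f z * cnj (poly g z)) + \<i> * (of_real (Im z) * (poly f z * cnj (poly g z)))"
      by (subst (1) complex_eq) (simp add: algebra_simps)
    then show "?w z * (poly ([:0, 1:] * f - Polynomial.smult (of_real (s1\<^sup>2 - s2\<^sup>2)) (pderiv f)) z * cnj (poly g z)) =
      ?w z * (of_real (Re z) * (poly f z * cnj (poly g z))) + \<i> * (?w z * (of_real (Im z) * (poly f z * cnj (poly g z))))
       - of_real (s1\<^sup>2 - s2\<^sup>2) * (?w z * (poly (pderiv f) z * cnj (poly g z)))"
      by simp Groebner_Basis.algebra
  qed
  also have "\<dots> = (\<integral>z. ?w z * (of_real (Re z) * (poly f z * cnj (poly g z))) \<partial>lborel)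
     + \<i> * (\<integral>z. ?w z * (of_real (Im z) * (poly f z * cnj (poly g z))) \<partial>lborel)
     - of_real (s1\<^sup>2 - s2\<^sup>2) * gauss_inner s1 s2 (pderiv f) g"
    using ints by (simp add: gauss_inner_def)
  also have "\<dots> = of_real (s1\<^sup>2 + s2\<^sup>2) * gauss_inner s1 s2 f (pderiv g)"
    unfolding stein_Re stein_Im by (simp add: algebra_simps)
  finally show ?thesis .
qed

lemma gauss_inner_commute: "gauss_inner s1 s2 g f = cnj (gauss_inner s1 s2 f g)"
  unfolding gauss_inner_def by (simp flip: Bochner_Integration.integral_cnj add: mult_ac)

text \<open>Each raising operator that generates the left factor becomes, up to the factor \<open>s1\<^sup>2 + s2\<^sup>2\<close>, a
  derivative of the right factor, and differentiation lowers Hermite polynomials by one degree.\<close>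
theorem hermite_orthogonal:
  "gauss_inner s1 s2 (hermite (of_real (s1\<^sup>2 - s2\<^sup>2)) n) (hermite (of_real (s1\<^sup>2 - s2\<^sup>2)) m) =
     (if n = m then of_real ((s1\<^sup>2 + s2\<^sup>2) ^ n * fact n) else 0)"
proof -
  define \<sigma> where "\<sigma> = complex_of_real (s1\<^sup>2 - s2\<^sup>2)"
  let ?H = "hermite \<sigma>" and ?s = "complex_of_real (s1\<^sup>2 + s2\<^sup>2)"
  have raise: "gauss_inner s1 s2 (?H (Suc n)) g = ?s * gauss_inner s1 s2 (?H n) (pderiv g)" for n g
    unfolding hermite.simps(2) \<sigma>_def by (rule gauss_inner_raise)
  have zero: "gauss_inner s1 s2 f 0 = 0" for f by (simp add: gauss_inner_def)
  have smult: "gauss_inner s1 s2 f (Polynomial.smult (of_nat k) g) = of_nat k * gauss_inner s1 s2 f g" for f g k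
    by (simp add: gauss_inner_def flip: integral_mult_right_zero) (simp add: mult_ac)
  have one: "gauss_inner s1 s2 1 1 = 1"
    using has_bochner_integral_integral_eq[OF has_bochner_integral_gauss2[OF pos]] by (simp add: gauss_inner_def)
  have "gauss_inner s1 s2 (?H n) (?H m) = (if n = m then ?s ^ n * fact n else 0)"
  proof (induction n arbitrary: m)
    case 0
    show ?case
    proof (cases m)
      case (Suc k)
      have "gauss_inner s1 s2 1 (?H (Suc k)) = cnj (gauss_inner s1 s2 (?H (Suc k)) 1)" by (rule gauss_inner_commute)
      then show ?thesis using Suc by (simp add: raise zero del: hermite.simps(2))
    qed (simp add: one)
  next
    case (Suc n)
    show ?case
    proof (cases m)
      case 0
      then show ?thesis by (simp add: raise zero del: hermite.simps(2))
    next
      case (Suc k)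
      then show ?thesis
        by (simp add: raise pderiv_hermite smult Suc.IH del: hermite.simps of_nat_Suc)
    qed
  qed
  then show ?thesis by (simp add: \<sigma>_def)
qed

end

section \<open>The 1-point function of a quadratic potential\<close>

text \<open>The term of level \<open>n\<close> in the 1-point function for \<open>N Q = a \<xi>\<^sup>2 + b \<eta>\<^sup>2\<close>, divided by \<open>N \<Delta>Q = (a + b) / 2\<close>.
  In terms of the variances \<open>1 / (2 a)\<close> and \<open>1 / (2 b)\<close> of the weight, the Hermite parameter is their
  difference, and their sum is the base of the power in the squared norm.\<close>
definition level_weight :: "real \<Rightarrow> real \<Rightarrow> complex \<Rightarrow> nat \<Rightarrow> real" where
  "level_weight a b z n = 2 * sqrt (a * b) / (a + b) * exp (- a * (Re z)\<^sup>2 - b * (Im z)\<^sup>2)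
     * (cmod (poly (hermite (of_real ((b - a) / (2 * a * b))) n) z))\<^sup>2 / (((a + b) / (2 * a * b)) ^ n * fact n)"

lemma level_weight_nonneg: "a > 0 \<Longrightarrow> b > 0 \<Longrightarrow> level_weight a b z n \<ge> 0"
  by (simp add: level_weight_def)

text \<open>At \<open>r = 1\<close> the right-hand side is \<open>1\<close>: the weights are a probability distribution on the levels.\<close>
theorem level_weight_generating_function:
  fixes a b r :: real
  assumes ab: "a > 0" "b > 0" and r: "0 \<le> r" "r \<le> 1"
  defines "\<tau> \<equiv> (b - a) / (a + b)"
  shows "(\<lambda>n. level_weight a b z n * r ^ n) sums
    (sqrt ((1 - \<tau>\<^sup>2) / (1 - (\<tau> * r)\<^sup>2)) *
     exp (- (1 - r) * (a * (Re z)\<^sup>2 / (1 + \<tau> * r) + b * (Im z)\<^sup>2 / (1 - \<tau> * r))))"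
proof -
  define \<sigma> s where "\<sigma> = (b - a) / (2 * a * b)" and "s = (a + b) / (2 * a * b)"
  have s: "s > 0" "\<sigma> / s = \<tau>" using ab by (simp_all add: s_def \<sigma>_def \<tau>_def)
  have \<tau>1: "\<bar>\<tau>\<bar> < 1" using ab by (auto simp: \<tau>_def abs_less_iff field_simps)
  have sr: "\<sigma> * (r / s) = \<tau> * r" by (simp add: s(2)[symmetric])
  have \<tau>r: "\<bar>\<tau> * r\<bar> < 1"
    using \<tau>1 r mult_mono[of "\<bar>\<tau>\<bar>" "\<bar>\<tau>\<bar>" r 1] by (simp add: abs_mult)
  define c where "c = 2 * sqrt (a * b) / (a + b) * exp (- a * (Re z)\<^sup>2 - b * (Im z)\<^sup>2)"
  have "(\<lambda>n. c * ((cmod (poly (hermite (complex_of_real \<sigma>) n) z))\<^sup>2 / fact n * (r / s) ^ n)) sums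
    (c * (exp (r / s * (Re z)\<^sup>2 / (1 + \<tau> * r) + r / s * (Im z)\<^sup>2 / (1 - \<tau> * r)) / sqrt (1 - (\<tau> * r)\<^sup>2)))"
    using mehler_formula_diagonal[of \<sigma> "r / s" z] \<tau>r unfolding sr by (intro sums_mult) simp
  also have "(\<lambda>n. c * ((cmod (poly (hermite (complex_of_real \<sigma>) n) z))\<^sup>2 / fact n * (r / s) ^ n)) = (\<lambda>n. level_weight a b z n * r ^ n)"
  proof
    fix n
    have "level_weight a b z n = c * (cmod (poly (hermite (complex_of_real \<sigma>) n) z))\<^sup>2 / (s ^ n * fact n)"
      by (simp only: level_weight_def c_def s_def \<sigma>_def)
    then show "c * ((cmod (poly (hermite (complex_of_real \<sigma>) n) z))\<^sup>2 / fact n * (r / s) ^ n) = level_weight a b z n * r ^ n"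
      by (simp add: power_divide mult_ac)
  qed
  also have "c * (exp (r / s * (Re z)\<^sup>2 / (1 + \<tau> * r) + r / s * (Im z)\<^sup>2 / (1 - \<tau> * r)) / sqrt (1 - (\<tau> * r)\<^sup>2)) =
    sqrt ((1 - \<tau>\<^sup>2) / (1 - (\<tau> * r)\<^sup>2)) *
     exp (- (1 - r) * (a * (Re z)\<^sup>2 / (1 + \<tau> * r) + b * (Im z)\<^sup>2 / (1 - \<tau> * r)))"
  proof -
    have sa: "1 / s = a * (1 + \<tau>)" "1 / s = b * (1 - \<tau>)"
      using ab by (simp_all add: s_def \<tau>_def field_simps)
    have shift: "r * (1 + \<tau>) / (1 + \<tau> * r) - 1 = - (1 - r) / (1 + \<tau> * r)"
      "r * (1 - \<tau>) / (1 - \<tau> * r) - 1 = - (1 - r) / (1 - \<tau> * r)"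
      using \<tau>r by (simp_all add: abs_less_iff field_simps)
    have "r / s * (Re z)\<^sup>2 / (1 + \<tau> * r) = a * (Re z)\<^sup>2 * (r * (1 + \<tau>) / (1 + \<tau> * r))"
      "r / s * (Im z)\<^sup>2 / (1 - \<tau> * r) = b * (Im z)\<^sup>2 * (r * (1 - \<tau>) / (1 - \<tau> * r))"
      using sa by (simp_all add: divide_inverse mult_ac)
    then have "- a * (Re z)\<^sup>2 - b * (Im z)\<^sup>2 + (r / s * (Re z)\<^sup>2 / (1 + \<tau> * r) + r / s * (Im z)\<^sup>2 / (1 - \<tau> * r)) =
      a * (Re z)\<^sup>2 * (r * (1 + \<tau>) / (1 + \<tau> * r) - 1) + b * (Im z)\<^sup>2 * (r * (1 - \<tau>) / (1 - \<tau> * r) - 1)"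
      by (simp add: algebra_simps)
    also have "\<dots> = - (1 - r) * (a * (Re z)\<^sup>2 / (1 + \<tau> * r) + b * (Im z)\<^sup>2 / (1 - \<tau> * r))"
      unfolding shift by (simp add: divide_inverse algebra_simps)
    finally have e: "exp (- a * (Re z)\<^sup>2 - b * (Im z)\<^sup>2) * exp (r / s * (Re z)\<^sup>2 / (1 + \<tau> * r) + r / s * (Im z)\<^sup>2 / (1 - \<tau> * r)) =
      exp (- (1 - r) * (a * (Re z)\<^sup>2 / (1 + \<tau> * r) + b * (Im z)\<^sup>2 / (1 - \<tau> * r)))"
      by (simp flip: exp_add)
    have "1 - \<tau>\<^sup>2 = 4 * (a * b) / (a + b)\<^sup>2"
      using ab by (simp add: \<tau>_def power_divide field_simps) (simp add: power2_eq_square algebra_simps)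
    then have q: "sqrt (1 - \<tau>\<^sup>2) = 2 * sqrt (a * b) / (a + b)"
      using ab by (simp add: real_sqrt_divide real_sqrt_mult)
    show ?thesis unfolding c_def real_sqrt_divide q e[symmetric] by (simp add: mult_ac)
  qed
  finally show ?thesis .
qed

lemma exp_neg_quadratic_eq_gauss2:
  assumes "a > 0" "b > 0"
  shows "exp (- a * (Re z)\<^sup>2 - b * (Im z)\<^sup>2) =
    pi / sqrt (a * b) * gauss2 (sqrt (1 / (2 * a))) (sqrt (1 / (2 * b))) z"
proof -
  have nd: "normal_density 0 (sqrt (1 / (2 * d))) x = sqrt d / sqrt pi * exp (- d * x\<^sup>2)" if "d > 0" for d x
  proof -
    have "(sqrt (1 / (2 * d)))\<^sup>2 = 1 / (2 * d)"
      using that by (intro real_sqrt_pow2) simp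
    moreover have "sqrt (2 * pi * (1 / (2 * d))) = sqrt pi / sqrt d"
      using that by (simp add: real_sqrt_divide)
    ultimately show ?thesis using that unfolding normal_density_def by simp
  qed
  show ?thesis
    using assms unfolding gauss2_def nd[OF assms(1)] nd[OF assms(2)]
    by (simp add: real_sqrt_mult exp_diff exp_minus field_simps flip: exp_add)
qed

theorem one_point_function_quadratic:
  assumes N: "N > 0" and ab: "a > 0" "b > 0"
    and Q: "\<And>z. real N * Q z = a * (Re z)\<^sup>2 + b * (Im z)\<^sup>2"
  shows "one_point_function N Q w = (a + b) / 2 * (\<Sum>n<N. level_weight a b w n)"
proof -
  define s1 s2 where "s1 = sqrt (1 / (2 * a))" and "s2 = sqrt (1 / (2 * b))"
  have pos: "s1 > 0" "s2 > 0" using ab by (simp_all add: s1_def s2_def)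
  define \<sigma> s where "\<sigma> = (b - a) / (2 * a * b)" and "s = (a + b) / (2 * a * b)"
  have \<sigma>s: "s1\<^sup>2 - s2\<^sup>2 = \<sigma>" "s1\<^sup>2 + s2\<^sup>2 = s"
    using ab by (simp_all add: s1_def s2_def \<sigma>_def s_def field_simps)
  let ?H = "hermite (complex_of_real \<sigma>)"
  \<comment> \<open>\<open>q\<close> is the total mass of \<open>exp (- N Q) dA\<close>.\<close>
  define q where "q = 1 / sqrt (a * b)"
  have expQ: "exp (- real N * Q z) = pi * q * gauss2 s1 s2 z" for z
  proof -
    have "- real N * Q z = - a * (Re z)\<^sup>2 - b * (Im z)\<^sup>2" using Q[of z] by simp
    then show ?thesis using exp_neg_quadratic_eq_gauss2[OF ab, of z] by (simp add: s1_def s2_def q_def)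
  qed
  have Q': "Q = (\<lambda>z. (a * (Re z)\<^sup>2 + b * (Im z)\<^sup>2) / real N)"
    using Q N by (auto simp: field_simps)
  have contQ: "continuous_on UNIV Q" unfolding Q' by (intro continuous_intros) (use N in auto)
  define \<nu> where "\<nu> k = q * (s ^ k * fact k)" for k
  have bridge: "has_bochner_integral area_measure (\<lambda>z. of_real (exp (- real N * Q z)) * (poly f z * cnj (poly g z)))
     (of_real q * gauss_inner s1 s2 f g)" for f g
  proof -
    have "has_bochner_integral lborel (\<lambda>z. of_real q * (of_real (gauss2 s1 s2 z) * (poly f z * cnj (poly g z))))
       (of_real q * gauss_inner s1 s2 f g)"
      unfolding gauss_inner_def by (intro has_bochner_integral_mult_right has_bochner_integral_integrable integrable_inner pos)
    also have "(\<lambda>z. of_real q * (of_real (gauss2 s1 s2 z) * (poly f z * cnj (poly g z)))) =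
       (\<lambda>z. (1 / pi) *\<^sub>R (of_real (exp (- real N * Q z)) * (poly f z * cnj (poly g z))))"
      unfolding expQ by (simp add: scaleR_conv_of_real)
    finally have "has_bochner_integral lborel (\<lambda>z. (1 / pi) *\<^sub>R (of_real (exp (- real N * Q z)) * (poly f z * cnj (poly g z))))
       (of_real q * gauss_inner s1 s2 f g)" .
    moreover have "(\<lambda>z. complex_of_real (exp (- real N * Q z)) * (poly f z * cnj (poly g z))) \<in> borel_measurable borel"
      by (intro borel_measurable_continuous_onI continuous_intros contQ)
    ultimately show ?thesis
      unfolding area_measure_def by (intro has_bochner_integral_density) simp_all
  qed
  have "one_point_function N Q w = (\<Sum>k<N. (cmod (poly (?H k) w))\<^sup>2 / \<nu> k) * exp (- real N * Q w)"
  proof (rule one_point_function_orthogonal_polynomials[OF contQ N])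
    show "degree (?H n) = n" "lead_coeff (?H n) = 1" for n
      using degree_hermite[of "complex_of_real \<sigma>" n] by auto
    show "integrable area_measure (\<lambda>z. of_real (exp (- real N * Q z)) * (poly (?H k) z * cnj (poly (?H l) z)))" for k l
      using bridge by (rule integrable.intros)
    show "(\<integral>z. of_real (exp (- real N * Q z)) * (poly (?H k) z * cnj (poly (?H l) z)) \<partial>area_measure)
       = (if k = l then of_real (\<nu> k) else 0)" for k l
      using has_bochner_integral_integral_eq[OF bridge] hermite_orthogonal[OF pos, of k l]
      unfolding \<sigma>s by (simp add: \<nu>_def)
    show "\<nu> k > 0" for k using ab by (simp add: \<nu>_def q_def s_def)
  qed
  also have "\<dots> = (\<Sum>n<N. (a + b) / 2 * level_weight a b w n)"
    unfolding sum_distrib_right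
  proof (rule sum.cong[OF refl])
    fix k
    have "level_weight a b w k = 2 / q / (a + b) * exp (- real N * Q w) * (cmod (poly (?H k) w))\<^sup>2 / (s ^ k * fact k) * (q * sqrt (a * b))"
    proof -
      have "- real N * Q w = - a * (Re w)\<^sup>2 - b * (Im w)\<^sup>2" using Q[of w] by simp
      then show ?thesis using ab by (simp only: level_weight_def \<sigma>_def s_def q_def) simp
    qed
    then show "(cmod (poly (?H k) w))\<^sup>2 / \<nu> k * exp (- real N * Q w) = (a + b) / 2 * level_weight a b w k"
      using ab by (simp add: \<nu>_def q_def)
  qed
  finally show ?thesis by (simp add: sum_distrib_left)
qed

lemma quarter_laplacian_potential:
  "quarter_laplacian (potential c N) z = (1 + real N / c\<^sup>2) / 4"
proof -
  have d: "deriv (deriv (\<lambda>x::real. (1 / 2) * k * x\<^sup>2 + C)) y = k" for k C y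
  proof -
    have "deriv (\<lambda>x. (1 / 2) * k * x\<^sup>2 + C) = (\<lambda>x. k * x)"
      by (rule ext, rule DERIV_imp_deriv) (auto intro!: derivative_eq_intros)
    then show ?thesis by (simp add: DERIV_imp_deriv[OF DERIV_cmult_Id])
  qed
  show ?thesis
    unfolding quarter_laplacian_def potential_def
    using d[of 1 "(1 / 2) * (real N / c\<^sup>2) * (Im z)\<^sup>2" "Re z"] d[of "real N / c\<^sup>2" "(1 / 2) * (Re z)\<^sup>2" "Im z"]
    by (simp add: add.commute)
qed

lemma rescaled_one_point_function_eq:
  assumes c: "c > 0" and N: "N > 0"
  defines "a \<equiv> real N / 2" and "b \<equiv> (real N)\<^sup>2 / (2 * c\<^sup>2)"
  shows "rescaled_one_point_function N (potential c N) p z =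
     (\<Sum>n<N. level_weight a b (p + z / of_real (sqrt ((a + b) / 2))) n)"
proof -
  have ab: "a > 0" "b > 0" using c N by (simp_all add: a_def b_def)
  have lap: "real N * quarter_laplacian (potential c N) p = (a + b) / 2" for p
    using c by (simp add: quarter_laplacian_potential a_def b_def field_simps power2_eq_square)
  have Q: "real N * potential c N z = a * (Re z)\<^sup>2 + b * (Im z)\<^sup>2" for z
    using c by (simp add: potential_def a_def b_def field_simps power2_eq_square)
  show ?thesis
    unfolding rescaled_one_point_function_def lap one_point_function_quadratic[OF N ab Q]
    using ab by simp
qed

section \<open>The method of moments on the unit interval\<close>

text \<open>By Weierstrass, the continuous test functions \<open>cts_step\<close> that characterise weak convergence are
  uniform limits of polynomials on \<open>[0, 1]\<close>.\<close>
theorem weak_conv_m_if_moments_converge: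
  fixes M_seq :: "nat \<Rightarrow> real measure" and M :: "real measure"
  assumes M_seq: "\<And>n. real_distribution (M_seq n)" and M: "real_distribution M"
    and supp_seq: "\<And>n. AE x in M_seq n. x \<in> {0..1}" and supp: "AE x in M. x \<in> {0..1}"
    and moments: "\<And>k. (\<lambda>n. \<integral>x. x ^ k \<partial>M_seq n) \<longlonglongrightarrow> (\<integral>x. x ^ k \<partial>M)"
  shows "weak_conv_m M_seq M"
proof (rule integral_cts_step_conv_imp_weak_conv[OF M_seq M])
  fix a b :: real assume ab: "a < b"
  have pow_int: "integrable \<mu> (\<lambda>x. x ^ k)" if "real_distribution \<mu>" "AE x in \<mu>. x \<in> {0..1}" for k and \<mu> :: "real measure"
  proof -
    interpret real_distribution \<mu> by fact
    have "AE x in \<mu>. norm (x ^ k) \<le> 1"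
      using that(2) by eventually_elim (auto simp: power_le_one)
    then show ?thesis by (intro integrable_const_bound[of _ 1]) simp_all
  qed
  show "(\<lambda>n. integral\<^sup>L (M_seq n) (cts_step a b)) \<longlonglongrightarrow> integral\<^sup>L M (cts_step a b)"
  proof (rule LIMSEQ_I)
    fix e :: real assume "0 < e"
    then have e: "e / 3 > 0" by simp
    have "continuous_on {0..1} (cts_step a b)"
      using cts_step_uniformly_continuous[OF ab] uniformly_continuous_imp_continuous
      by (blast intro: continuous_on_subset)
    then obtain g where g: "real_polynomial_function g" "\<And>x. x \<in> {0..1} \<Longrightarrow> \<bar>cts_step a b x - g x\<bar> < e / 3"
      using Stone_Weierstrass_real_polynomial_function[OF _ _ e] by (metis compact_Icc)
    obtain c d where c: "g = (\<lambda>x. \<Sum>i\<le>d. c i * x ^ i)"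
      using g(1) unfolding real_polynomial_function_iff_sum by blast
    have near: "\<bar>integral\<^sup>L \<mu> (cts_step a b) - (\<Sum>i\<le>d. c i * (\<integral>x. x ^ i \<partial>\<mu>))\<bar> \<le> e / 3"
      if \<mu>: "real_distribution \<mu>" "AE x in \<mu>. x \<in> {0..1}" for \<mu> :: "real measure"
    proof -
      interpret real_distribution \<mu> by fact
      have gi: "has_bochner_integral \<mu> g (\<Sum>i\<le>d. c i * (\<integral>x. x ^ i \<partial>\<mu>))"
        unfolding c using pow_int[OF \<mu>]
        by (intro has_bochner_integral_sum has_bochner_integral_mult_right has_bochner_integral_integrable)
      then have gint: "integrable \<mu> g" by (rule integrable.intros)
      have fint: "integrable \<mu> (cts_step a b)" by (rule integrable_cts_step[OF ab])
      have "\<bar>\<integral>x. (cts_step a b x - g x) \<partial>\<mu>\<bar> \<le> (\<integral>x. \<bar>cts_step a b x - g x\<bar> \<partial>\<mu>)"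
        by (rule integral_abs_bound)
      also have "\<dots> \<le> (\<integral>x. e / 3 \<partial>\<mu>)"
      proof (rule integral_mono_AE)
        show "AE x in \<mu>. \<bar>cts_step a b x - g x\<bar> \<le> e / 3"
          using \<mu>(2) by eventually_elim (rule less_imp_le[OF g(2)])
      qed (use fint gint in simp_all)
      finally show ?thesis
        using fint gint has_bochner_integral_integral_eq[OF gi] prob_space by simp
    qed
    have "(\<lambda>n. \<Sum>i\<le>d. c i * (\<integral>x. x ^ i \<partial>M_seq n)) \<longlonglongrightarrow> (\<Sum>i\<le>d. c i * (\<integral>x. x ^ i \<partial>M))"
      by (intro tendsto_intros moments)
    from LIMSEQ_D[OF this e] obtain n0 where
      n0: "\<And>n. n \<ge> n0 \<Longrightarrow> \<bar>(\<Sum>i\<le>d. c i * (\<integral>x. x ^ i \<partial>M_seq n)) - (\<Sum>i\<le>d. c i * (\<integral>x. x ^ i \<partial>M))\<bar> < e / 3"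
      by auto
    show "\<exists>n0. \<forall>n\<ge>n0. norm (integral\<^sup>L (M_seq n) (cts_step a b) - integral\<^sup>L M (cts_step a b)) < e"
    proof (intro exI allI impI)
      fix n assume "n \<ge> n0"
      show "norm (integral\<^sup>L (M_seq n) (cts_step a b) - integral\<^sup>L M (cts_step a b)) < e"
        using n0[OF \<open>n \<ge> n0\<close>] near[OF M_seq supp_seq, of n] near[OF M supp] by (simp only: real_norm_def)
    qed
  qed
qed

text \<open>The series in the hypothesis \<open>moments\<close> is the \<open>k\<close>-th moment of \<open>exp (- n / N)\<close> for a random level \<open>n\<close>
  with distribution \<open>W j\<close>. The event \<open>n < N\<close> reads \<open>exp (- n / N) > exp (- 1)\<close>, so the partial sums are
  tails of distribution functions at \<open>exp (- 1)\<close>, where the limit law has no atom. The exponential maps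
  the unbounded range of \<open>n / N\<close> into \<open>[0, 1]\<close>, where moments determine weak convergence.\<close>
lemma partial_sums_tendsto_if_moments_converge:
  fixes W :: "nat \<Rightarrow> nat \<Rightarrow> real" and N :: "nat \<Rightarrow> nat" and M :: "real measure"
  assumes N: "\<And>j. N j > 0" and nonneg: "\<And>j n. W j n \<ge> 0" and total: "\<And>j. W j sums 1"
    and M: "real_distribution M" and supp: "AE x in M. x \<in> {0..1}"
    and no_atom: "measure M {exp (- 1)} = 0"
    and moments: "\<And>k. (\<lambda>j. \<Sum>n. W j n * exp (- real k / real (N j)) ^ n) \<longlonglongrightarrow> (\<integral>x. x ^ k \<partial>M)"
  shows "(\<lambda>j. \<Sum>n<N j. W j n) \<longlonglongrightarrow> measure M {exp (- 1)<..}"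
proof -
  interpret M: real_distribution M by (rule M)
  define p where "p j = embed_pmf (W j)" for j
  have pmf_p: "pmf (p j) n = W j n" for j n
    unfolding p_def
  proof (rule pmf_embed_pmf[OF nonneg])
    have "(\<integral>\<^sup>+ n. ennreal (W j n) \<partial>count_space UNIV) = (\<Sum>n. ennreal (W j n))"
      by (rule nn_integral_count_space_nat)
    also have "\<dots> = ennreal 1"
      by (rule suminf_ennreal_eq[OF nonneg total])
    finally show "(\<integral>\<^sup>+ n. ennreal (W j n) \<partial>count_space UNIV) = 1" by simp
  qed
  define g where "g j n = exp (- real n / real (N j))" for j n
  define L where "L j = distr (measure_pmf (p j)) borel (g j)" for j
  have L: "real_distribution (L j)" for j
    unfolding L_def by (intro prob_space.real_distribution_distr prob_space_measure_pmf) simp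
  have "weak_conv_m L M"
  proof (rule weak_conv_m_if_moments_converge[OF L M _ supp])
    show "AE x in L j. x \<in> {0..1}" for j
      unfolding L_def by (subst AE_distr_iff) (auto simp: g_def)
    have "(\<integral>x. x ^ k \<partial>L j) = (\<Sum>n. W j n * exp (- real k / real (N j)) ^ n)" for j k
    proof -
      have gk: "g j n ^ k = exp (- real k / real (N j)) ^ n" for n
        by (simp add: g_def mult_ac flip: exp_of_nat_mult)
      have int: "integrable (measure_pmf (p j)) (\<lambda>n. g j n ^ k)"
        by (intro measure_pmf.integrable_const_bound[of _ 1]) (auto simp: g_def power_le_one)
      have "(\<integral>x. x ^ k \<partial>L j) = (\<integral>n. g j n ^ k \<partial>measure_pmf (p j))"
        unfolding L_def by (subst integral_distr) simp_all
      also have "\<dots> = (\<integral>n. W j n * g j n ^ k \<partial>count_space UNIV)"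
        unfolding measure_pmf_eq_density by (subst integral_density) (auto simp: pmf_p nonneg)
      also have "\<dots> = (\<Sum>n. W j n * g j n ^ k)"
      proof (rule sums_unique[OF sums_integral_count_space_nat])
        show "integrable (count_space UNIV) (\<lambda>n. W j n * g j n ^ k)"
          using int unfolding measure_pmf_eq_density by (subst (asm) integrable_density) (auto simp: pmf_p nonneg)
      qed
      finally show ?thesis by (simp add: gk)
    qed
    then show "(\<lambda>j. \<integral>x. x ^ k \<partial>L j) \<longlonglongrightarrow> (\<integral>x. x ^ k \<partial>M)" for k
      using moments[of k] by simp
  qed
  then have conv: "(\<lambda>j. cdf (L j) (exp (- 1))) \<longlonglongrightarrow> cdf M (exp (- 1))"
    using no_atom by (simp add: weak_conv_m_def weak_conv_def M.isCont_cdf)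
  have "cdf (L j) (exp (- 1)) = 1 - (\<Sum>n<N j. W j n)" for j
  proof -
    have "g j -` {..exp (- 1)} = - {..<N j}"
      using N[of j] by (auto simp: g_def field_simps)
    then have "cdf (L j) (exp (- 1)) = measure_pmf.prob (p j) (- {..<N j})"
      by (simp add: cdf_def L_def measure_distr)
    also have "\<dots> = 1 - measure_pmf.prob (p j) {..<N j}"
      using measure_pmf.prob_compl[of "{..<N j}" "p j"] by (simp add: Compl_eq_Diff_UNIV)
    also have "measure_pmf.prob (p j) {..<N j} = (\<Sum>n<N j. W j n)"
      by (simp add: measure_measure_pmf_finite pmf_p)
    finally show ?thesis .
  qed
  moreover have "cdf M (exp (- 1)) = 1 - measure M {exp (- 1)<..}"
  proof -
    have compl: "{exp (- 1)<..} = space M - {..exp (- 1 :: real)}" by auto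
    have "measure M {exp (- 1)<..} = 1 - measure M {..exp (- 1)}"
      unfolding compl by (rule M.prob_compl) simp
    then show ?thesis unfolding cdf_def by simp
  qed
  ultimately have "(\<lambda>j. 1 - (\<Sum>n<N j. W j n)) \<longlonglongrightarrow> 1 - measure M {exp (- 1)<..}"
    using conv by simp
  from tendsto_diff[OF tendsto_const[of 1] this] show ?thesis by (simp only: diff_diff_eq2 add_diff_cancel_left')
qed

section \<open>The limiting law of the level\<close>

text \<open>Completing the square turns the integrand into a multiple of another normal density.\<close>
lemma integral_normal_exp_neg_square:
  assumes "l \<ge> 0"
  shows "(\<integral>t. normal_density \<mu> 1 t * exp (- l * t\<^sup>2) \<partial>lborel) = exp (- l * \<mu>\<^sup>2 / (1 + 2 * l)) / sqrt (1 + 2 * l)"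
proof -
  define v where "v = 1 / sqrt (1 + 2 * l)"
  have v: "v > 0" "v\<^sup>2 = 1 / (1 + 2 * l)" using assms by (simp_all add: v_def power_divide)
  have "normal_density \<mu> 1 t * exp (- l * t\<^sup>2) =
     exp (- l * \<mu>\<^sup>2 / (1 + 2 * l)) / sqrt (1 + 2 * l) * normal_density (\<mu> * v\<^sup>2) v t" for t
  proof -
    have e: "- (t - \<mu>)\<^sup>2 / 2 + - l * t\<^sup>2 = - l * \<mu>\<^sup>2 / (1 + 2 * l) + - (t - \<mu> * v\<^sup>2)\<^sup>2 / (2 * v\<^sup>2)"
    proof -
      define K where "K = 1 + 2 * l"
      have K: "K \<noteq> 0" using assms by (simp add: K_def)
      have "(t - \<mu> * v\<^sup>2)\<^sup>2 / (2 * v\<^sup>2) = (t * K - \<mu>)\<^sup>2 / (2 * K)"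
        using K unfolding v(2) K_def[symmetric] by (simp add: field_simps power2_eq_square)
      moreover have "- (t - \<mu>)\<^sup>2 / 2 + - l * t\<^sup>2 = (- 2 * l * \<mu>\<^sup>2 - (t * K - \<mu>)\<^sup>2) / (2 * K)"
      proof -
        have "- (t - \<mu>)\<^sup>2 * K - 2 * l * t\<^sup>2 * K = - 2 * l * \<mu>\<^sup>2 - (t * K - \<mu>)\<^sup>2"
          unfolding K_def by Groebner_Basis.algebra
        then show ?thesis using K by (simp add: field_simps)
      qed
      ultimately show ?thesis using K unfolding K_def[symmetric] by (simp add: field_simps)
    qed
    have s: "sqrt (2 * pi * v\<^sup>2) = sqrt (2 * pi) / sqrt (1 + 2 * l)"
      using v assms by (simp add: real_sqrt_mult real_sqrt_divide)
    have nz: "sqrt (1 + 2 * l) \<noteq> 0" using assms by simp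
    have "normal_density \<mu> 1 t * exp (- l * t\<^sup>2) = 1 / sqrt (2 * pi) * exp (- (t - \<mu>)\<^sup>2 / 2 + - l * t\<^sup>2)"
      by (simp add: normal_density_def flip: exp_add)
    also have "\<dots> = 1 / sqrt (2 * pi) * (exp (- l * \<mu>\<^sup>2 / (1 + 2 * l)) * exp (- (t - \<mu> * v\<^sup>2)\<^sup>2 / (2 * v\<^sup>2)))"
      unfolding e exp_add ..
    also have "\<dots> = exp (- l * \<mu>\<^sup>2 / (1 + 2 * l)) / sqrt (1 + 2 * l) * normal_density (\<mu> * v\<^sup>2) v t"
      unfolding normal_density_def s using nz by simp
    finally show ?thesis .
  qed
  then show ?thesis using v(1) by simp
qed

text \<open>The limit of the laws of \<open>exp (- n / N)\<close>, recognised by its moments. The summand \<open>p\<^sup>2 / 4\<close> is the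
  contribution of the real coordinate, which becomes deterministic, and the normal variable \<open>t\<close> comes from
  the imaginary coordinate.\<close>
definition limit_law :: "real \<Rightarrow> real \<Rightarrow> real \<Rightarrow> real measure" where
  "limit_law c p \<mu> = distr (density lborel (normal_density \<mu> 1)) borel (\<lambda>t. exp (- (p\<^sup>2 / 4 + t\<^sup>2 / (4 * c\<^sup>2))))"

lemma real_distribution_limit_law: "real_distribution (limit_law c p \<mu>)"
proof -
  interpret prob_space "density lborel (normal_density \<mu> 1)" by (rule prob_space_normal_density) simp
  show ?thesis unfolding limit_law_def by (intro real_distribution_distr) simp
qed

lemma limit_law_supp: "AE x in limit_law c p \<mu>. x \<in> {0..1}"
proof -
  have "exp (- (p\<^sup>2 / 4 + t\<^sup>2 / (4 * c\<^sup>2))) \<in> {0..1}" for t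
  proof -
    have "0 \<le> p\<^sup>2 / 4 + t\<^sup>2 / (4 * c\<^sup>2)" by (intro add_nonneg_nonneg) simp_all
    then show ?thesis by (simp only: atLeastAtMost_iff exp_ge_zero exp_le_one_iff neg_le_0_iff_le simp_thms)
  qed
  then show ?thesis unfolding limit_law_def by (subst AE_distr_iff) (simp, simp, blast intro: AE_I2)
qed

lemma limit_law_moment:
  assumes "c > 0"
  shows "(\<integral>x. x ^ k \<partial>limit_law c p \<mu>) =
    exp (- real k * p\<^sup>2 / 4) * exp (- real k * \<mu>\<^sup>2 / (2 * (2 * c\<^sup>2 + real k))) * sqrt (2 * c\<^sup>2 / (2 * c\<^sup>2 + real k))"
proof -
  define l where "l = real k / (4 * c\<^sup>2)"
  have l: "l \<ge> 0" by (simp add: l_def)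
  define E where "E t = exp (- (p\<^sup>2 / 4 + t\<^sup>2 / (4 * c\<^sup>2)))" for t :: real
  have E_meas: "E \<in> borel_measurable borel" unfolding E_def by simp
  have E_pow: "E t ^ k = exp (- real k * p\<^sup>2 / 4) * exp (- l * t\<^sup>2)" for t
    by (simp add: E_def l_def algebra_simps flip: exp_of_nat_mult exp_add)
  have "(\<integral>x. x ^ k \<partial>limit_law c p \<mu>) = (\<integral>t. E t ^ k \<partial>density lborel (normal_density \<mu> 1))"
    unfolding limit_law_def E_def[symmetric] using E_meas by (subst integral_distr) simp_all
  also have "\<dots> = (\<integral>t. normal_density \<mu> 1 t * E t ^ k \<partial>lborel)"
    using E_meas by (subst integral_density) simp_all
  also have "\<dots> = (\<integral>t. normal_density \<mu> 1 t * (exp (- real k * p\<^sup>2 / 4) * exp (- l * t\<^sup>2)) \<partial>lborel)"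
    unfolding E_pow ..
  also have "\<dots> = exp (- real k * p\<^sup>2 / 4) * (\<integral>t. normal_density \<mu> 1 t * exp (- l * t\<^sup>2) \<partial>lborel)"
    unfolding mult.left_commute[of "normal_density \<mu> 1 _"] by (rule integral_mult_right_zero)
  also have "\<dots> = exp (- real k * p\<^sup>2 / 4) * (exp (- l * \<mu>\<^sup>2 / (1 + 2 * l)) / sqrt (1 + 2 * l))"
    unfolding integral_normal_exp_neg_square[OF l] ..
  also have "1 + 2 * l = (2 * c\<^sup>2 + real k) / (2 * c\<^sup>2)"
    using assms by (simp add: l_def field_simps)
  also have "- l * \<mu>\<^sup>2 / ((2 * c\<^sup>2 + real k) / (2 * c\<^sup>2)) = - real k * \<mu>\<^sup>2 / (2 * (2 * c\<^sup>2 + real k))"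
    using assms by (simp add: l_def)
  finally show ?thesis by (simp add: real_sqrt_divide)
qed

lemma measure_limit_law_eq:
  assumes "A \<in> sets borel"
  shows "measure (limit_law c p \<mu>) A = measure (density lborel (normal_density \<mu> 1)) {t. exp (- (p\<^sup>2 / 4 + t\<^sup>2 / (4 * c\<^sup>2))) \<in> A}"
  unfolding limit_law_def using assms by (subst measure_distr) (auto simp: vimage_def)

lemma limit_law_no_atom:
  assumes "c > 0"
  shows "measure (limit_law c p \<mu>) {x} = 0"
proof -
  define d where "d = 4 * c\<^sup>2 * (- ln x - p\<^sup>2 / 4)"
  have "{t. exp (- (p\<^sup>2 / 4 + t\<^sup>2 / (4 * c\<^sup>2))) \<in> {x}} \<subseteq> {sqrt d, - sqrt d}"
  proof
    fix t assume "t \<in> {t. exp (- (p\<^sup>2 / 4 + t\<^sup>2 / (4 * c\<^sup>2))) \<in> {x}}"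
    then have "ln x = - (p\<^sup>2 / 4 + t\<^sup>2 / (4 * c\<^sup>2))" by auto
    then have "t\<^sup>2 = d" using assms by (simp add: d_def field_simps)
    then show "t \<in> {sqrt d, - sqrt d}" by (auto simp: abs_if split: if_splits)
  qed
  then have "finite {t. exp (- (p\<^sup>2 / 4 + t\<^sup>2 / (4 * c\<^sup>2))) \<in> {x}}" by (rule finite_subset) simp
  then have "{t. exp (- (p\<^sup>2 / 4 + t\<^sup>2 / (4 * c\<^sup>2))) \<in> {x}} \<in> null_sets lborel" by (rule finite_imp_null_set_lborel)
  then have "{t. exp (- (p\<^sup>2 / 4 + t\<^sup>2 / (4 * c\<^sup>2))) \<in> {x}} \<in> null_sets (density lborel (normal_density \<mu> 1))"
    by (auto simp: null_sets_density_iff dest: AE_not_in)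
  then show ?thesis by (subst measure_limit_law_eq) (auto simp: measure_eq_0_null_sets)
qed

text \<open>The event is \<open>T\<^sup>2 < c\<^sup>2 (4 - p\<^sup>2)\<close>, and \<open>c sqrt (4 - p\<^sup>2)\<close> is twice \<open>\<pi> c\<close> times the semicircle density.\<close>
lemma limit_law_tail:
  assumes c: "c > 0" and p: "\<bar>p\<bar> < 2"
  shows "measure (limit_law c p \<mu>) {exp (- 1)<..} = limit_profile (pi * c * semicircle_density p) \<mu>"
proof -
  define A where "A = 2 * (pi * c * semicircle_density p)"
  have p4: "p\<^sup>2 < 4" using p by (simp add: abs_square_less_1[of "p / 2", unfolded power_divide, simplified])
  have "indicator {-2..2} p = (1 :: real)" using p by (auto simp: indicator_def)
  then have A: "A = c * sqrt (4 - p\<^sup>2)" by (simp add: A_def semicircle_density_def)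
  have A0: "A > 0" using p4 c by (simp add: A)
  have A2: "A\<^sup>2 = c\<^sup>2 * (4 - p\<^sup>2)" using p4 by (simp add: A power_mult_distrib)
  have "{t. exp (- (p\<^sup>2 / 4 + t\<^sup>2 / (4 * c\<^sup>2))) \<in> {exp (- 1 :: real)<..}} = {- A<..<A}"
  proof -
    have "exp (- (p\<^sup>2 / 4 + t\<^sup>2 / (4 * c\<^sup>2))) \<in> {exp (- 1 :: real)<..} \<longleftrightarrow> t\<^sup>2 < A\<^sup>2" for t
      using c unfolding A2 by (simp add: field_simps)
    also have "t\<^sup>2 < A\<^sup>2 \<longleftrightarrow> t \<in> {- A<..<A}" for t
      using A0 abs_le_square_iff[of A t] by (auto simp flip: not_le)
    finally show ?thesis by blast
  qed
  then have "measure (limit_law c p \<mu>) {exp (- 1)<..} = measure (density lborel (normal_density \<mu> 1)) {- A<..<A}"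
    by (subst measure_limit_law_eq) simp_all
  also have "\<dots> = (\<integral>t. indicator {- A<..<A} t * normal_density \<mu> 1 t \<partial>lborel)"
  proof -
    have i: "integrable lborel (\<lambda>t. indicator {- A<..<A} t * normal_density \<mu> 1 t)"
      using integrable_mult_indicator[of "{- A<..<A}" lborel "normal_density \<mu> 1"] by simp
    have "emeasure (density lborel (normal_density \<mu> 1)) {- A<..<A} =
       (\<integral>\<^sup>+t. ennreal (indicator {- A<..<A} t * normal_density \<mu> 1 t) \<partial>lborel)"
      by (subst emeasure_density) (auto intro!: nn_integral_cong simp: indicator_def)
    also have "\<dots> = ennreal (\<integral>t. indicator {- A<..<A} t * normal_density \<mu> 1 t \<partial>lborel)"
      by (rule nn_integral_eq_integral[OF i]) simp
    finally show ?thesis by (simp add: measure_def integral_nonneg_AE)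
  qed
  also have "\<dots> = (\<integral>t. indicator {- A..A} t *\<^sub>R normal_density \<mu> 1 t \<partial>lborel)"
  proof (rule integral_cong_AE)
    have "AE t in lborel. t \<notin> {- A, A}" by (rule AE_not_in[OF finite_imp_null_set_lborel]) simp
    then show "AE t in lborel. indicator {- A<..<A} t * normal_density \<mu> 1 t = indicator {- A..A} t *\<^sub>R normal_density \<mu> 1 t"
      by eventually_elim (auto simp: indicator_def)
  qed simp_all
  also have "\<dots> = integral {- A..A} (normal_density \<mu> 1)"
    using set_borel_integral_eq_integral(2)[of "{- A..A}" "normal_density \<mu> 1"]
      integrable_mult_indicator[of "{- A..A}" lborel "normal_density \<mu> 1"]
    by (simp add: set_lebesgue_integral_def set_integrable_def)
  also have "\<dots> = integral {- A..A} (\<lambda>t. 1 / sqrt (2 * pi) * exp (- (1 / 2) * (\<mu> - t)\<^sup>2))"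
    by (intro integral_cong) (simp add: normal_density_def power2_commute)
  also have "\<dots> = limit_profile (pi * c * semicircle_density p) \<mu>"
    by (simp only: limit_profile_def integral_mult_right A_def mult_minus_left)
  finally show ?thesis .
qed

section \<open>Passage to the limit\<close>

text \<open>The two coordinates contribute at different scales. With \<open>N (1 - r)\<close> tending to \<open>k\<close> and \<open>N (1 - \<tau>)\<close> to
  \<open>2 c\<^sup>2\<close>, also \<open>N (1 - \<tau> r)\<close> tends to \<open>2 c\<^sup>2 + k\<close>. The real part of the point tends to \<open>p\<close>, and its square is
  multiplied by \<open>(1 - r) N / 2\<close>, which is bounded; the imaginary part is of order \<open>1 / N\<close>, which
  is compensated by the factor \<open>N\<^sup>2 / (2 c\<^sup>2)\<close> in the potential. Everything else is continuity.\<close>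
lemma generating_function_limit:
  fixes N :: "nat \<Rightarrow> nat" and z :: "nat \<Rightarrow> complex" and c p :: real
  assumes c: "c > 0" and N: "filterlim N at_top sequentially" and z: "z \<longlonglongrightarrow> z0" and k: "k \<ge> 0"
  defines "a \<equiv> \<lambda>j. real (N j) / 2" and "b \<equiv> \<lambda>j. (real (N j))\<^sup>2 / (2 * c\<^sup>2)"
  defines "\<tau> \<equiv> \<lambda>j. (b j - a j) / (a j + b j)"
    and "w \<equiv> \<lambda>j. of_real p + z j / of_real (sqrt ((a j + b j) / 2))" and "r \<equiv> \<lambda>j. exp (- k / real (N j))"
  shows "(\<lambda>j. sqrt ((1 - (\<tau> j)\<^sup>2) / (1 - (\<tau> j * r j)\<^sup>2)) *
     exp (- (1 - r j) * (a j * (Re (w j))\<^sup>2 / (1 + \<tau> j * r j) + b j * (Im (w j))\<^sup>2 / (1 - \<tau> j * r j))))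
    \<longlonglongrightarrow> exp (- k * p\<^sup>2 / 4) * exp (- k * (2 * Im z0)\<^sup>2 / (2 * (2 * c\<^sup>2 + k))) * sqrt (2 * c\<^sup>2 / (2 * c\<^sup>2 + k))"
proof -
  have Nr: "filterlim (\<lambda>j. real (N j)) at_top sequentially"
    using N by (rule filterlim_compose[OF filterlim_real_sequentially])
  have Npos: "eventually (\<lambda>j. N j > 0) sequentially"
    using N[unfolded filterlim_at_top, rule_format, of 1] by eventually_elim simp
  have c2: "c\<^sup>2 > 0" using c by simp
  have Nr_r: "(\<lambda>j. real (N j) * (1 - r j)) \<longlonglongrightarrow> k"
  proof -
    have "((\<lambda>x. x * (1 - exp (- k / x))) \<longlongrightarrow> k) at_top" by real_asymp
    from filterlim_compose[OF this Nr] show ?thesis by (simp add: r_def)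
  qed
  have r1: "r \<longlonglongrightarrow> 1"
  proof -
    have "((\<lambda>x::real. exp (- k / x)) \<longlongrightarrow> 1) at_top" by real_asymp
    from filterlim_compose[OF this Nr] show ?thesis by (simp add: r_def)
  qed
  have \<tau>_eq: "eventually (\<lambda>j. \<tau> j = (real (N j) - c\<^sup>2) / (real (N j) + c\<^sup>2)) sequentially"
    using Npos
  proof eventually_elim
    case (elim j)
    have quot: "x\<^sup>2 / (2 * C) - x / 2 = x / (2 * C) * (x - C)" "x / 2 + x\<^sup>2 / (2 * C) = x / (2 * C) * (x + C)"
      if "C > 0" for x C :: real
      using that by (simp_all add: field_simps power2_eq_square)
    have "b j - a j = real (N j) / (2 * c\<^sup>2) * (real (N j) - c\<^sup>2)" "a j + b j = real (N j) / (2 * c\<^sup>2) * (real (N j) + c\<^sup>2)"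
      using quot[OF c2] by (simp_all add: a_def b_def)
    then show ?case using elim c2 by (simp add: \<tau>_def)
  qed
  have N_\<tau>: "(\<lambda>j. real (N j) * (1 - \<tau> j)) \<longlonglongrightarrow> 2 * c\<^sup>2"
  proof -
    have "((\<lambda>x. x * (1 - (x - c\<^sup>2) / (x + c\<^sup>2))) \<longlongrightarrow> 2 * c\<^sup>2) at_top" by real_asymp
    from filterlim_compose[OF this Nr] show ?thesis
      by (rule Lim_transform_eventually) (use \<tau>_eq in eventually_elim, simp)
  qed
  have \<tau>1: "\<tau> \<longlonglongrightarrow> 1"
  proof -
    have "((\<lambda>x. (x - c\<^sup>2) / (x + c\<^sup>2)) \<longlongrightarrow> 1) at_top" by real_asymp
    from filterlim_compose[OF this Nr] show ?thesis
      by (rule Lim_transform_eventually) (use \<tau>_eq in eventually_elim, simp)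
  qed
  \<comment> \<open>Split \<open>1 - \<tau> r = (1 - \<tau>) + \<tau> (1 - r)\<close>.\<close>
  have N_\<tau>r: "(\<lambda>j. real (N j) * (1 - \<tau> j * r j)) \<longlonglongrightarrow> 2 * c\<^sup>2 + k"
  proof -
    have "(\<lambda>j. real (N j) * (1 - \<tau> j) + \<tau> j * (real (N j) * (1 - r j))) \<longlonglongrightarrow> 2 * c\<^sup>2 + 1 * k"
      by (intro tendsto_intros N_\<tau> \<tau>1 Nr_r)
    then show ?thesis by (simp add: algebra_simps)
  qed
  have A_inv: "(\<lambda>j. 1 / sqrt ((a j + b j) / 2)) \<longlonglongrightarrow> 0"
  proof -
    have "((\<lambda>x. 1 / sqrt ((x / 2 + x\<^sup>2 / (2 * c\<^sup>2)) / 2)) \<longlongrightarrow> 0) at_top" using c2 by real_asymp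
    from filterlim_compose[OF this Nr] show ?thesis by (simp add: a_def b_def)
  qed
  have Re_w: "(\<lambda>j. Re (w j)) \<longlonglongrightarrow> p"
  proof -
    have "(\<lambda>j. p + Re (z j) * (1 / sqrt ((a j + b j) / 2))) \<longlonglongrightarrow> p + Re z0 * 0"
      by (intro tendsto_intros z A_inv)
    then show ?thesis by (simp add: w_def Re_divide_of_real)
  qed
  have b_Im_w: "(\<lambda>j. b j * (Im (w j))\<^sup>2) \<longlonglongrightarrow> 2 * (Im z0)\<^sup>2"
  proof -
    have "((\<lambda>x. x\<^sup>2 / (2 * c\<^sup>2) / ((x / 2 + x\<^sup>2 / (2 * c\<^sup>2)) / 2)) \<longlongrightarrow> 2) at_top" using c2 by real_asymp
    from filterlim_compose[OF this Nr]
    have ratio: "(\<lambda>j. b j / ((a j + b j) / 2)) \<longlonglongrightarrow> 2" by (simp add: a_def b_def)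
    have "(\<lambda>j. b j / ((a j + b j) / 2) * (Im (z j))\<^sup>2) \<longlonglongrightarrow> 2 * (Im z0)\<^sup>2"
      by (intro tendsto_intros z ratio)
    moreover have "b j / ((a j + b j) / 2) * (Im (z j))\<^sup>2 = b j * (Im (w j))\<^sup>2" for j
    proof -
      have "(a j + b j) / 2 \<ge> 0" by (simp add: a_def b_def)
      then have S: "(sqrt ((a j + b j) / 2))\<^sup>2 = (a j + b j) / 2" by (rule real_sqrt_pow2)
      have "Im (w j) = Im (z j) / sqrt ((a j + b j) / 2)" by (simp only: w_def) simp
      then show ?thesis unfolding power_divide S by (simp only: power_divide S) simp
    qed
    ultimately show ?thesis by simp
  qed
  let ?n = "\<lambda>j. real (N j)"
  have "(\<lambda>j. sqrt ((?n j * (1 - \<tau> j)) * (1 + \<tau> j) / ((?n j * (1 - \<tau> j * r j)) * (1 + \<tau> j * r j))) *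
     exp (- ((?n j * (1 - r j)) * (1 / 2) * (Re (w j))\<^sup>2 / (1 + \<tau> j * r j)
         + (?n j * (1 - r j)) * (b j * (Im (w j))\<^sup>2) / (?n j * (1 - \<tau> j * r j)))))
    \<longlonglongrightarrow> sqrt ((2 * c\<^sup>2) * (1 + 1) / ((2 * c\<^sup>2 + k) * (1 + 1 * 1))) *
     exp (- (k * (1 / 2) * p\<^sup>2 / (1 + 1 * 1) + k * (2 * (Im z0)\<^sup>2) / (2 * c\<^sup>2 + k)))"
  proof -
    have "(\<lambda>j. sqrt (u j * (1 + t j) / (v j * (1 + t j * q j))) *
        exp (- (m j * (1 / 2) * (x j)\<^sup>2 / (1 + t j * q j) + m j * y j / v j)))
      \<longlonglongrightarrow> sqrt ((2 * c\<^sup>2) * (1 + 1) / ((2 * c\<^sup>2 + k) * (1 + 1 * 1))) *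
        exp (- (k * (1 / 2) * p\<^sup>2 / (1 + 1 * 1) + k * (2 * (Im z0)\<^sup>2) / (2 * c\<^sup>2 + k)))"
      if "u \<longlonglongrightarrow> 2 * c\<^sup>2" "v \<longlonglongrightarrow> 2 * c\<^sup>2 + k" "t \<longlonglongrightarrow> 1" "q \<longlonglongrightarrow> 1" "m \<longlonglongrightarrow> k" "x \<longlonglongrightarrow> p"
        "y \<longlonglongrightarrow> 2 * (Im z0)\<^sup>2" for u v t q m x y :: "nat \<Rightarrow> real"
    proof -
      have "2 * c\<^sup>2 + k \<noteq> 0" using c2 k by linarith
      then show ?thesis by (intro tendsto_intros that) simp_all
    qed
    from this[OF N_\<tau> N_\<tau>r \<tau>1 r1 Nr_r Re_w b_Im_w] show ?thesis .
  qed
  also have "sqrt ((2 * c\<^sup>2) * (1 + 1) / ((2 * c\<^sup>2 + k) * (1 + 1 * 1))) *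
     exp (- (k * (1 / 2) * p\<^sup>2 / (1 + 1 * 1) + k * (2 * (Im z0)\<^sup>2) / (2 * c\<^sup>2 + k))) =
     exp (- k * p\<^sup>2 / 4) * exp (- k * (2 * Im z0)\<^sup>2 / (2 * (2 * c\<^sup>2 + k))) * sqrt (2 * c\<^sup>2 / (2 * c\<^sup>2 + k))"
  proof -
    have 1: "k * (2 * (Im z0)\<^sup>2) / (2 * c\<^sup>2 + k) = k * (2 * Im z0)\<^sup>2 / (2 * (2 * c\<^sup>2 + k))"
    proof -
      have "k * (2 * y\<^sup>2) / D = k * (2 * y)\<^sup>2 / (2 * D)" for y D :: real
        by (simp add: power2_eq_square)
      then show ?thesis .
    qed
    have 2: "(2 * c\<^sup>2) * (1 + 1) / ((2 * c\<^sup>2 + k) * (1 + 1 * 1)) = 2 * c\<^sup>2 / (2 * c\<^sup>2 + k)"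
    proof -
      have "x * (1 + 1) / (D * (1 + 1 * 1)) = x / D" for x D :: real by simp
      then show ?thesis .
    qed
    show ?thesis unfolding 1 2 minus_add_distrib exp_add by (simp add: mult.commute)
  qed
  finally show ?thesis
  proof (rule Lim_transform_eventually)
    show "\<forall>\<^sub>F j in sequentially.
      sqrt ((?n j * (1 - \<tau> j)) * (1 + \<tau> j) / ((?n j * (1 - \<tau> j * r j)) * (1 + \<tau> j * r j))) *
       exp (- ((?n j * (1 - r j)) * (1 / 2) * (Re (w j))\<^sup>2 / (1 + \<tau> j * r j)
         + (?n j * (1 - r j)) * (b j * (Im (w j))\<^sup>2) / (?n j * (1 - \<tau> j * r j)))) =
      sqrt ((1 - (\<tau> j)\<^sup>2) / (1 - (\<tau> j * r j)\<^sup>2)) *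
       exp (- (1 - r j) * (a j * (Re (w j))\<^sup>2 / (1 + \<tau> j * r j) + b j * (Im (w j))\<^sup>2 / (1 - \<tau> j * r j)))"
      using Npos
    proof eventually_elim
      case (elim j)
      have sq: "1 - x\<^sup>2 = (1 - x) * (1 + x)" for x :: real by (simp add: power2_eq_square algebra_simps)
      have 1: "(?n j * (1 - \<tau> j)) * (1 + \<tau> j) / ((?n j * (1 - \<tau> j * r j)) * (1 + \<tau> j * r j)) = (1 - (\<tau> j)\<^sup>2) / (1 - (\<tau> j * r j)\<^sup>2)"
        unfolding sq using elim by (simp only: mult.assoc mult_divide_mult_cancel_left)
      have 2: "- ((?n j * (1 - r j)) * (1 / 2) * (Re (w j))\<^sup>2 / (1 + \<tau> j * r j)
         + (?n j * (1 - r j)) * (b j * (Im (w j))\<^sup>2) / (?n j * (1 - \<tau> j * r j))) =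
         - (1 - r j) * (a j * (Re (w j))\<^sup>2 / (1 + \<tau> j * r j) + b j * (Im (w j))\<^sup>2 / (1 - \<tau> j * r j))"
      proof -
        have "- ((n * q) * (1 / 2) * X / D + (n * q) * Y / (n * E)) = - q * (n / 2 * X / D + Y / E)"
          if "n \<noteq> 0" for n q X D Y E :: real
        proof -
          have "(n * q) * Y / (n * E) = q * (Y / E)" using that by simp
          then show ?thesis by (simp add: algebra_simps)
        qed
        then show ?thesis using elim by (simp only: a_def)
      qed
      show ?case unfolding 1 2 ..
    qed
  qed
qed

lemma rescaled_one_point_tendsto:
  fixes N :: "nat \<Rightarrow> nat" and z :: "nat \<Rightarrow> complex"
  assumes c: "c > 0" and p: "\<bar>p\<bar> < 2" and N: "filterlim N at_top sequentially" "\<And>j. N j > 0"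
    and z: "z \<longlonglongrightarrow> z0"
  shows "(\<lambda>j. rescaled_one_point_function (N j) (potential c (N j)) (complex_of_real p) (z j))
    \<longlonglongrightarrow> limit_profile (pi * c * semicircle_density p) (2 * Im z0)"
proof -
  define a b where "a j = real (N j) / 2" and "b j = (real (N j))\<^sup>2 / (2 * c\<^sup>2)" for j
  have ab: "a j > 0" "b j > 0" for j using N(2)[of j] c by (simp_all add: a_def b_def)
  define w where "w j = complex_of_real p + z j / of_real (sqrt ((a j + b j) / 2))" for j
  define W where "W j = level_weight (a j) (b j) (w j)" for j
  have gf: "W j sums 1" for j
  proof -
    have "\<bar>(b j - a j) / (a j + b j)\<bar> < 1" using ab[of j] by (auto simp: abs_less_iff field_simps)
    then have "1 - ((b j - a j) / (a j + b j))\<^sup>2 \<noteq> 0" by (metis abs_square_less_1 less_irrefl right_minus_eq)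
    then show ?thesis
      using level_weight_generating_function[OF ab(1)[of j] ab(2)[of j], of 1 "w j"] by (simp add: W_def)
  qed
  have "(\<lambda>j. \<Sum>n<N j. W j n) \<longlonglongrightarrow> measure (limit_law c p (2 * Im z0)) {exp (- 1)<..}"
  proof (rule partial_sums_tendsto_if_moments_converge[OF N(2) _ gf real_distribution_limit_law limit_law_supp limit_law_no_atom[OF c]])
    show "W j n \<ge> 0" for j n unfolding W_def by (rule level_weight_nonneg[OF ab])
    fix k
    have "(\<Sum>n. W j n * exp (- real k / real (N j)) ^ n) =
      (let \<tau> = (b j - a j) / (a j + b j); r = exp (- real k / real (N j)) in
       sqrt ((1 - \<tau>\<^sup>2) / (1 - (\<tau> * r)\<^sup>2)) *
       exp (- (1 - r) * (a j * (Re (w j))\<^sup>2 / (1 + \<tau> * r) + b j * (Im (w j))\<^sup>2 / (1 - \<tau> * r))))" for j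
      unfolding W_def Let_def
      by (rule sums_unique[symmetric, OF level_weight_generating_function[OF ab]]) simp_all
    then show "(\<lambda>j. \<Sum>n. W j n * exp (- real k / real (N j)) ^ n) \<longlonglongrightarrow> (\<integral>x. x ^ k \<partial>limit_law c p (2 * Im z0))"
      unfolding limit_law_moment[OF c] Let_def
      using generating_function_limit[OF c N(1) z, of "real k" p] by (simp add: a_def b_def w_def)
  qed
  then show ?thesis
    unfolding limit_law_tail[OF c p] rescaled_one_point_function_eq[OF c N(2)] W_def w_def a_def b_def .
qed

text \<open>If uniform convergence failed, there would be infinitely many indices with points of \<open>K\<close> at which
  the functions stay away from the limit; along a convergent subsequence of these points the hypothesis
  and continuity of the limit contradict this.\<close>
lemma uniform_limit_compact_if_continuous_convergence:
  fixes f :: "nat \<Rightarrow> 'a::metric_space \<Rightarrow> 'b::metric_space"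
  assumes K: "compact K" and l: "continuous_on K l"
    and conv: "\<And>N z z0. \<lbrakk>strict_mono N; \<And>j. z j \<in> K; z0 \<in> K; z \<longlonglongrightarrow> z0\<rbrakk> \<Longrightarrow> (\<lambda>j. f (N j) (z j)) \<longlonglongrightarrow> l z0"
  shows "uniform_limit K f l sequentially"
proof (rule ccontr)
  assume "\<not> uniform_limit K f l sequentially"
  then obtain e where e: "e > 0" "\<And>n0. \<exists>n\<ge>n0. \<exists>x\<in>K. dist (f n x) (l x) \<ge> e"
    unfolding uniform_limit_sequentially_iff by (meson not_less)
  define bad where "bad n \<longleftrightarrow> (\<exists>x\<in>K. dist (f n x) (l x) \<ge> e)" for n
  have "infinite {n. bad n}"
    unfolding infinite_nat_iff_unbounded_le using e(2) by (auto simp: bad_def)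
  then obtain M :: "nat \<Rightarrow> nat" where M: "strict_mono M" "\<And>j. bad (M j)"
    using infinite_enumerate by blast
  obtain x where x: "\<And>j. x j \<in> K" "\<And>j. dist (f (M j) (x j)) (l (x j)) \<ge> e"
    using M(2) unfolding bad_def by metis
  obtain z0 s where s: "z0 \<in> K" "strict_mono s" "(x \<circ> s) \<longlonglongrightarrow> z0"
    using K x(1) unfolding compact_def by blast
  have "(\<lambda>j. f (M (s j)) (x (s j))) \<longlonglongrightarrow> l z0"
    using conv[OF strict_mono_o[OF M(1) s(2)], of "x \<circ> s" z0] s x(1) by (simp add: o_def)
  moreover have "(\<lambda>j. l (x (s j))) \<longlonglongrightarrow> l z0"
    using l s x(1) unfolding continuous_on_sequentially by (auto simp: o_def)
  ultimately have "(\<lambda>j. dist (f (M (s j)) (x (s j))) (l (x (s j)))) \<longlonglongrightarrow> dist (l z0) (l z0)"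
    by (rule tendsto_dist)
  then have "eventually (\<lambda>j. dist (f (M (s j)) (x (s j))) (l (x (s j))) < e) sequentially"
    using e(1) by (intro order_tendstoD) auto
  then show False using x(2) by (auto simp: eventually_sequentially not_less[symmetric])
qed

lemma continuous_on_limit_profile: "continuous_on UNIV (limit_profile A)"
proof -
  have "continuous_on UNIV (\<lambda>x. integral (cbox (-2 * A) (2 * A)) (\<lambda>t. exp (- (1 / 2) * (x - t)\<^sup>2)))"
    by (intro integral_continuous_on_param continuous_intros) (auto simp: case_prod_unfold intro!: continuous_intros)
  then show ?thesis
    unfolding limit_profile_def by (intro continuous_intros) (simp add: cbox_interval)
qed

theorem theorem1p4:
  fixes c p :: real
  assumes "c > 0" and "-2 < p" and "p < 2"
  shows "\<forall>K. compact K \<longrightarrow>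
           uniform_limit K
             (\<lambda>N z. rescaled_one_point_function N (potential c N) (complex_of_real p) z)
             (\<lambda>z. limit_profile (pi * c * semicircle_density p) (2 * Im z))
             sequentially"
proof (intro allI impI)
  fix K :: "complex set" assume K: "compact K"
  have p: "\<bar>p\<bar> < 2" using assms by auto
  show "uniform_limit K
             (\<lambda>N z. rescaled_one_point_function N (potential c N) (complex_of_real p) z)
             (\<lambda>z. limit_profile (pi * c * semicircle_density p) (2 * Im z))
             sequentially"
  proof (rule uniform_limit_compact_if_continuous_convergence[OF K])
    show "continuous_on K (\<lambda>z. limit_profile (pi * c * semicircle_density p) (2 * Im z))"
      by (intro continuous_on_compose2[OF continuous_on_limit_profile] continuous_intros) auto
    fix N :: "nat \<Rightarrow> nat" and z :: "nat \<Rightarrow> complex" and z0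
    assume N: "strict_mono N" and z: "z \<longlonglongrightarrow> z0"
    \<comment> \<open>Shift the sequence by one, because \<open>N 0\<close> may be \<open>0\<close>.\<close>
    have "filterlim (\<lambda>j. N (Suc j)) at_top sequentially"
      by (rule filterlim_compose[OF filterlim_subseq[OF N] filterlim_Suc])
    moreover have "N (Suc j) > 0" for j using strict_mono_imp_increasing[OF N, of "Suc j"] by simp
    moreover have "(\<lambda>j. z (Suc j)) \<longlonglongrightarrow> z0" using z by (rule LIMSEQ_Suc)
    ultimately have "(\<lambda>j. rescaled_one_point_function (N (Suc j)) (potential c (N (Suc j))) (complex_of_real p) (z (Suc j)))
       \<longlonglongrightarrow> limit_profile (pi * c * semicircle_density p) (2 * Im z0)"
      by (rule rescaled_one_point_tendsto[OF assms(1) p])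
    then show "(\<lambda>j. rescaled_one_point_function (N j) (potential c (N j)) (complex_of_real p) (z j))
       \<longlonglongrightarrow> limit_profile (pi * c * semicircle_density p) (2 * Im z0)"
      by (rule LIMSEQ_imp_Suc)
  qed
qed

end
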